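(* Given positive integers $n$ and $\rho$ with $n \geq 5$ and $3 \leq \rho \leq n$, there exists an I-isolated smooth Fano $n$-polytope with $n+\rho$ vertices.
   Context: A lattice $n$-polytope is an $n$-dimensional convex polytope $P\subset\mathbb{R}^n$ whose vertices lie in $\mathbb{Z}^n$; $V(P)$ denotes its vertex set. It is a smooth Fano $n$-polytope if the origin is in its interior and the vertex set of each facet of $P$ is a $\mathbb{Z}$-basis of $\mathbb{Z}^n$. Two lattice polytopes $Q,Q'\subset\mathbb{R}^n$ are unimodularly equivalent if there is an affine map $\phi:\mathbb{R}^n\to\mathbb{R}^n$ with $\phi(\mathbb{Z}^n)=\mathbb{Z}^n$ and $\phi(Q)=Q'$. $\mathcal{F}(n)$ denotes the set of smooth Fano $n$-polytopes up to unimodular equivalence. Two smooth Fano $n$-polytopes $P$ and $Q$ are I-equivalent if there is a sequence $P_0,P_1,\ldots,P_k$ of smooth Fano $n$-polytopes such that $P$ and $Q$ are unimodularly equivalent to $P_0$ and $P_k$, respectively, and for each $1\le i\le k$, for some lattice point $w$, either $V(P_i)=V(P_{i-1})\cup\{w\}$ with $w\notin V(P_{i-1})$, or $V(P_{i-1})=V(P_i)\cup\{w\}$ with $w\notin V(P_i)$. A smooth Fano $n$-polytope $P$ is I-isolated if no $P'\in\mathcal{F}(n)\setminus\{P\}$ is I-equivalent to $P$; i.e. every smooth Fano $n$-polytope I-equivalent to $P$ is unimodularly equivalent to $P$. *)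

theory Defs
  imports "HOL-Analysis.Analysis"
begin

text \<open>
  The ambient dimension \<open>n\<close> is \<open>CARD('n)\<close> for an arbitrary finite index type \<open>'n\<close>.
\<close>

definition int_lattice :: "(real ^ 'n) set" where
  "int_lattice = {x. \<forall>i. x $ i \<in> \<int>}"

definition vertices :: "(real ^ 'n) set \<Rightarrow> (real ^ 'n) set" where
  "vertices P = {v. v extreme_point_of P}"

definition lattice_polytope :: "(real ^ 'n) set \<Rightarrow> bool" where
  "lattice_polytope P \<longleftrightarrow>
     polytope P \<and> aff_dim P = int CARD('n) \<and> vertices P \<subseteq> int_lattice"

definition lattice_basis :: "(real ^ 'n) set \<Rightarrow> bool" where
  "lattice_basis B \<longleftrightarrow>
     finite B \<and> B \<subseteq> int_lattice \<and>
     (\<forall>c :: real ^ 'n \<Rightarrow> int.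
        (\<Sum>b\<in>B. of_int (c b) *\<^sub>R b) = 0 \<longrightarrow> (\<forall>b\<in>B. c b = 0)) \<and>
     (\<forall>x\<in>int_lattice. \<exists>c :: real ^ 'n \<Rightarrow> int. x = (\<Sum>b\<in>B. of_int (c b) *\<^sub>R b))"

definition smooth_fano :: "(real ^ 'n) set \<Rightarrow> bool" where
  "smooth_fano P \<longleftrightarrow>
     lattice_polytope P \<and> 0 \<in> interior P \<and>
     (\<forall>F. F facet_of P \<longrightarrow> lattice_basis (vertices F))"

definition affine_map :: "(real ^ 'n \<Rightarrow> real ^ 'n) \<Rightarrow> bool" where
  "affine_map \<phi> \<longleftrightarrow> (\<exists>f a. linear f \<and> \<phi> = (\<lambda>x. f x + a))"

definition unimodularly_equivalent :: "(real ^ 'n) set \<Rightarrow> (real ^ 'n) set \<Rightarrow> bool" where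
  "unimodularly_equivalent Q Q' \<longleftrightarrow>
     (\<exists>\<phi>. affine_map \<phi> \<and> \<phi> ` int_lattice = int_lattice \<and> \<phi> ` Q = Q')"

definition adds_vertex :: "(real ^ 'n) set \<Rightarrow> (real ^ 'n) set \<Rightarrow> bool" where
  "adds_vertex P Q \<longleftrightarrow>
     (\<exists>w\<in>int_lattice. w \<notin> vertices P \<and> vertices Q = vertices P \<union> {w})"

definition I_equivalent :: "(real ^ 'n) set \<Rightarrow> (real ^ 'n) set \<Rightarrow> bool" where
  "I_equivalent P Q \<longleftrightarrow>
     smooth_fano P \<and> smooth_fano Q \<and>
     (\<exists>(k :: nat) (R :: nat \<Rightarrow> (real ^ 'n) set).
        (\<forall>i\<le>k. smooth_fano (R i)) \<and>
        unimodularly_equivalent P (R 0) \<and>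
        unimodularly_equivalent Q (R k) \<and>
        (\<forall>i\<in>{1..k}. adds_vertex (R (i - 1)) (R i) \<or> adds_vertex (R i) (R (i - 1))))"

definition I_isolated :: "(real ^ 'n) set \<Rightarrow> bool" where
  "I_isolated P \<longleftrightarrow>
     smooth_fano P \<and>
     (\<forall>P'. smooth_fano P' \<and> I_equivalent P' P \<longrightarrow> unimodularly_equivalent P' P)"

end

theory Submission
  imports Defs
begin

text \<open>
  The polytopes that prove the theorem have five classes of vertices, namely \<open>K\<close> vertices \<open>v_i\<close>,
  \<open>p\<close> vertices \<open>y_i\<close>, \<open>p\<close> vertices \<open>u_i\<close>, a vertex \<open>z\<close> and a vertex \<open>t\<close>, together with
  \<open>m\<close> blocks of vertices \<open>s_{j,i}\<close>. Writing \<open>V\<close>, \<open>Y\<close>, \<open>U\<close>, \<open>S_j\<close> for the sums over the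
  classes, all linear relations between the vertices follow from

  \<^item> \<open>z + t = 0\<close>, \<open>V + Y = \<kappa> t\<close>, \<open>Y + z = U\<close>, and hence \<open>U + t = Y\<close>, where \<open>\<kappa> = K + p - 1\<close>,
  \<^item> \<open>S_j = \<alpha>_j Y + \<beta>_j U\<close>, where the block has \<open>p (\<alpha>_j + \<beta>_j) + 1\<close> elements.

  In all of them but the first, the vertices on the left outnumber the total weight on the right
  by exactly one. This is just enough for the polytope to be smooth Fano, and it leaves so little
  room that no vertex can be added or removed. The dimension is
  \<open>n = K + 2 p - 1 + \<Sum>_j p (\<alpha>_j + \<beta>_j)\<close> and there are \<open>n + 3 + m\<close> vertices. With \<open>K \<ge> 2\<close>, one
  block-free family with \<open>p = 2\<close> covers \<open>\<rho> = 3\<close>, and suitable blocks with \<open>p = 1\<close> cover every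
  \<open>\<rho> \<ge> 4\<close>.

  \<^bold>\<open>Smooth Fano.\<close> Let a linear functional be at most 1 on the vertices. By the relations it cannot
  be 1 on a whole block, nor on two neighbouring classes of the pentagon \<open>V, Y, z, t, U\<close>. So the
  level set of 1 misses an element of each block and of three classes, which leaves at most \<open>n\<close>
  vertices; if it spans, it is one of five explicit types
  (\<open>adm_facet_classification\<close>), and each of them generates the lattice (\<open>lattice_basis_tight\<close>).

  \<^bold>\<open>No vertex can be removed\<close> (\<open>no_vertex_removable\<close>). Most vertices are alone on the
  positive side of a hyperplane, so without them the origin is no longer in the interior. Otherwise
  the removed vertex is a lattice point of height at least two over some facet of the smaller
  polytope. The vertex \<open>t\<close> would then violate \<open>V + Y = \<kappa> t\<close>. A vertex \<open>y\<close> or \<open>u\<close> with \<open>p = 1\<close> is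
  the sum of two vertices, \<open>y = u + t\<close> or \<open>u = y + z\<close>, and also occurs on the right of a block
  relation; comparing heights puts the two summands and the block into one facet, on which they are
  linearly dependent.

  \<^bold>\<open>No vertex can be added\<close> (\<open>no_vertex_addable\<close>). Let \<open>w\<close> be a new vertex and call a facet visible
  if \<open>w\<close> has positive height over it. Smoothness of the larger polytope forces \<open>w\<close>, expressed
  in the basis of a visible facet, to have coefficient one opposite every wall to an invisible facet
  (\<open>horizon_height_difference\<close>). If the wall belongs to a relation of the above kind, then the height
  changes by one across it, but visible heights are at least two; hence visibility spreads across
  such walls. They connect the facets of the first four types, so these are all visible or all invisible.
  If they are visible, a certain sum of heights over three facets is both positive and at most zero,
  a contradiction. Otherwise the cone that contains \<open>w\<close> belongs to a facet of the fifth type, and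
  the horizon condition makes \<open>w\<close> so large that a neighbouring facet of the fourth type is visible.

  Since an I-equivalence to a polytope without such neighbours is a unimodular equivalence
  (\<open>I_isolatedI\<close>), this proves the theorem.
\<close>

section \<open>Facets of smooth Fano polytopes as functionals\<close>

definition tight :: "(real ^ 'n) set \<Rightarrow> real ^ 'n \<Rightarrow> (real ^ 'n) set" where
  "tight P a = {v \<in> vertices P. a \<bullet> v = 1}"

text \<open>
  Facets are represented by their outer normals, scaled so that the facet lies at height one;
  the vertices of the facet are then the tight vertices.
\<close>

definition facet_normal :: "(real ^ 'n) set \<Rightarrow> real ^ 'n \<Rightarrow> bool" where
  "facet_normal P a \<longleftrightarrow> (\<forall>v\<in>vertices P. a \<bullet> v \<le> 1) \<and> span (tight P a) = UNIV"

lemma tight_subset: "tight P a \<subseteq> vertices P"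
  by (auto simp: tight_def)

lemma facet_normal_le: "facet_normal P a \<Longrightarrow> v \<in> vertices P \<Longrightarrow> a \<bullet> v \<le> 1"
  by (simp add: facet_normal_def)

lemma polytope_finite_vertices: "polytope P \<Longrightarrow> finite (vertices P)"
  unfolding vertices_def
  by (intro finite_polyhedron_extreme_points polytope_imp_polyhedron)

lemma polytope_eq_hull_vertices:
  fixes P :: "(real ^ 'n) set"
  assumes "polytope P"
  shows "P = convex hull (vertices P)"
  unfolding vertices_def
  using Krein_Milman_Minkowski assms polytope_imp_compact polytope_imp_convex by blast

lemma polytope_normal_le:
  fixes P :: "(real ^ 'n) set"
  assumes "polytope P" "\<forall>v\<in>vertices P. a \<bullet> v \<le> 1" "x \<in> P"
  shows "a \<bullet> x \<le> 1"
proof -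
  have "convex hull (vertices P) \<subseteq> {x. a \<bullet> x \<le> 1}"
    using assms(2) by (intro hull_minimal convex_halfspace_le) auto
  then show ?thesis
    using polytope_eq_hull_vertices[OF assms(1)] assms(3) by auto
qed

lemma vertices_face:
  assumes "F face_of P"
  shows "vertices F = vertices P \<inter> F"
  using extreme_point_of_face[OF assms] by (auto simp: vertices_def)

text \<open>Adjoining the origin to a set that lies at height one raises its affine dimension by one.\<close>

lemma aff_dim_level_one:
  fixes T :: "(real ^ 'n) set"
  assumes "T \<subseteq> {x. a \<bullet> x = 1}"
  shows "aff_dim T = int (dim (span T)) - 1"
proof -
  have "affine hull T \<subseteq> {x. a \<bullet> x = 1}"
    using assms by (intro hull_minimal affine_hyperplane)
  then have "0 \<notin> affine hull T" by auto
  then have "aff_dim (insert 0 T) = aff_dim T + 1"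
    by (simp add: aff_dim_insert)
  moreover have "aff_dim (insert 0 T) = int (dim (insert 0 T))"
    by (intro aff_dim_zero hull_inc) auto
  moreover have "dim (insert 0 T) = dim (span T)"
    by (simp add: dim_insert span_zero)
  ultimately show ?thesis by simp
qed

lemma aff_dim_interior_nonempty:
  fixes P :: "(real ^ 'n) set"
  assumes "0 \<in> interior P"
  shows "aff_dim P = int CARD('n)"
  using aff_dim_nonempty_interior[of P] assms by auto

text \<open>
  A supporting hyperplane of a facet misses the interior point \<open>0\<close>, so it can be scaled to height
  one. Among the supporting hyperplanes at height one, those of facets are the ones whose tight
  vertices span, by comparing dimensions.
\<close>

lemma facet_of_iff_facet_normal:
  fixes P :: "(real ^ 'n) set"
  assumes P: "polytope P" and 0: "0 \<in> interior P"
  shows "F facet_of P \<longleftrightarrow> (\<exists>a. facet_normal P a \<and> F = P \<inter> {x. a \<bullet> x = 1})"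
proof
  assume F: "F facet_of P"
  then obtain a b where ab: "a \<noteq> 0" "P \<subseteq> {x. a \<bullet> x \<le> b}" "F = P \<inter> {x. a \<bullet> x = b}"
    using facet_of_polyhedron[OF polytope_imp_polyhedron[OF P]] by metis
  have "0 \<in> interior {x. a \<bullet> x \<le> b}"
    using 0 interior_mono[OF ab(2)] by auto
  then have b: "b > 0"
    using ab(1) by simp
  define c where "c = a /\<^sub>R b"
  have c1: "c \<bullet> x \<le> 1 \<longleftrightarrow> a \<bullet> x \<le> b" "c \<bullet> x = 1 \<longleftrightarrow> a \<bullet> x = b" for x
    using b by (auto simp: c_def field_simps)
  have face: "F face_of P"
    using F facet_of_imp_face_of by blast
  have Fc: "F = P \<inter> {x. c \<bullet> x = 1}"
    using ab(3) c1 by auto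
  have PV: "vertices P \<subseteq> P"
    by (auto simp: vertices_def extreme_point_of_def)
  have vF: "vertices F = tight P c"
    using vertices_face[OF face] Fc PV by (auto simp: tight_def)
  have "polytope F"
    using face P face_of_polytope_polytope by blast
  then have Fh: "F = convex hull (tight P c)"
    using polytope_eq_hull_vertices vF by metis
  have "aff_dim F = int CARD('n) - 1"
    using F aff_dim_interior_nonempty[OF 0] by (simp add: facet_of_def)
  moreover have "aff_dim F = aff_dim (tight P c)"
    by (subst Fh) (rule aff_dim_convex_hull)
  moreover have "aff_dim (tight P c) = int (dim (span (tight P c))) - 1"
    by (rule aff_dim_level_one[of _ c]) (auto simp: tight_def)
  ultimately have "dim (tight P c) = DIM(real ^ 'n)"
    by simp
  then have "span (tight P c) = UNIV"
    using dim_eq_full by blast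
  then have "facet_normal P c"
    using ab(2) c1 PV by (auto simp: facet_normal_def)
  then show "\<exists>a. facet_normal P a \<and> F = P \<inter> {x. a \<bullet> x = 1}"
    using Fc by blast
next
  assume "\<exists>a. facet_normal P a \<and> F = P \<inter> {x. a \<bullet> x = 1}"
  then obtain a where a: "facet_normal P a" and F: "F = P \<inter> {x. a \<bullet> x = 1}"
    by blast
  have face: "F face_of P"
    unfolding F using P a polytope_normal_le[OF P]
    by (intro face_of_Int_supporting_hyperplane_le) (auto simp: facet_normal_def polytope_imp_convex)
  have PV: "vertices P \<subseteq> P"
    by (auto simp: vertices_def extreme_point_of_def)
  have vF: "vertices F = tight P a"
    using vertices_face[OF face] F PV by (auto simp: tight_def)
  have "polytope F"
    using face P face_of_polytope_polytope by blast
  then have Fh: "F = convex hull (tight P a)"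
    using polytope_eq_hull_vertices vF by metis
  have "aff_dim F = aff_dim (tight P a)"
    by (subst Fh) (rule aff_dim_convex_hull)
  moreover have "aff_dim (tight P a) = int (dim (span (tight P a))) - 1"
    by (rule aff_dim_level_one[of _ a]) (auto simp: tight_def)
  moreover have "span (tight P a) = UNIV"
    using a by (simp add: facet_normal_def)
  ultimately have ad: "aff_dim F = int CARD('n) - 1"
    by simp
  have "tight P a \<noteq> {}"
  proof
    assume e: "tight P a = {}"
    have "span (tight P a) = UNIV" using a by (simp add: facet_normal_def)
    then have "(UNIV :: (real^'n) set) = {0}" using e by simp
    moreover have "axis undefined 1 \<noteq> (0 :: real^'n)"
      by (simp add: axis_eq_0_iff)
    ultimately show False by blast
  qed
  then have "F \<noteq> {}" using Fh by simp
  then show "F facet_of P"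
    using face ad aff_dim_interior_nonempty[OF 0] by (simp add: facet_of_def)
qed

lemma vertices_facet:
  fixes P :: "(real ^ 'n) set"
  assumes P: "polytope P" and a: "facet_normal P a"
  shows "vertices (P \<inter> {x. a \<bullet> x = 1}) = tight P a"
proof -
  have "P \<inter> {x. a \<bullet> x = 1} face_of P"
    using P a polytope_normal_le[OF P]
    by (intro face_of_Int_supporting_hyperplane_le) (auto simp: facet_normal_def polytope_imp_convex)
  from vertices_face[OF this] show ?thesis
    by (auto simp: tight_def vertices_def extreme_point_of_def)
qed

text \<open>
  This form of the definition mentions facets only through functionals on the vertices. It is used
  to verify that a polytope is smooth Fano and, in the other direction, to extract lattice bases.
\<close>

lemma smooth_fano_iff:
  fixes P :: "(real ^ 'n) set"
  shows "smooth_fano P \<longleftrightarrow> polytope P \<and> 0 \<in> interior P \<and> vertices P \<subseteq> int_lattice \<and>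
    (\<forall>a. facet_normal P a \<longrightarrow> lattice_basis (tight P a))"
proof (cases "polytope P \<and> 0 \<in> interior P")
  case True
  then have "(\<forall>F. F facet_of P \<longrightarrow> lattice_basis (vertices F)) \<longleftrightarrow>
    (\<forall>a. facet_normal P a \<longrightarrow> lattice_basis (tight P a))"
    using facet_of_iff_facet_normal[of P] vertices_facet[of P] by metis
  then show ?thesis
    using True aff_dim_interior_nonempty[of P] by (auto simp: smooth_fano_def lattice_polytope_def)
qed (auto simp: smooth_fano_def lattice_polytope_def)

lemma smooth_fanoD:
  fixes P :: "(real ^ 'n) set"
  assumes "smooth_fano P"
  shows "polytope P" "0 \<in> interior P" "vertices P \<subseteq> int_lattice" "finite (vertices P)"
    "facet_normal P a \<Longrightarrow> lattice_basis (tight P a)"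
  using assms polytope_finite_vertices by (auto simp: smooth_fano_iff)

lemma axis_in_int_lattice: "axis i 1 \<in> (int_lattice :: (real ^ 'n) set)"
  by (auto simp: int_lattice_def axis_def)

lemma lattice_basis_rep:
  fixes B :: "(real ^ 'n) set"
  assumes "lattice_basis B" "x \<in> int_lattice"
  obtains c :: "real ^ 'n \<Rightarrow> int" where "x = (\<Sum>b\<in>B. of_int (c b) *\<^sub>R b)"
  using assms unfolding lattice_basis_def by blast

lemma lattice_basis_span:
  fixes B :: "(real ^ 'n) set"
  assumes "lattice_basis B"
  shows "span B = UNIV"
proof -
  have "x \<in> span B" for x :: "real ^ 'n"
  proof -
    have "axis i 1 \<in> span B" for i
    proof -
      obtain c :: "real ^ 'n \<Rightarrow> int" where "axis i 1 = (\<Sum>b\<in>B. of_int (c b) *\<^sub>R b)"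
        using lattice_basis_rep[OF assms axis_in_int_lattice] by blast
      then show ?thesis by (auto intro: span_sum span_mul span_base)
    qed
    then have "(\<Sum>i\<in>UNIV. (x $ i) *\<^sub>R axis i 1) \<in> span B"
      by (intro span_sum span_mul)
    then show ?thesis
      using basis_expansion[of x] by (simp add: scalar_mult_eq_scaleR)
  qed
  then show ?thesis by auto
qed

text \<open>
  A lattice basis is only required to be independent over the integers. Real independence follows
  because the integral coordinates of the unit vectors with respect to \<open>B\<close> form a right inverse of
  the matrix with rows \<open>B\<close>.
\<close>

lemma lattice_basis_card_independent:
  fixes B :: "(real ^ 'n) set"
  assumes B: "lattice_basis B"
  shows "card B = CARD('n)" "independent B"
proof -
  have fin: "finite B" and BL: "B \<subseteq> int_lattice"
    and ind: "\<And>c :: real ^ 'n \<Rightarrow> int. (\<Sum>b\<in>B. of_int (c b) *\<^sub>R b) = 0 \<Longrightarrow> \<forall>b\<in>B. c b = 0"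
    using B by (auto simp: lattice_basis_def)
  have "\<forall>i. \<exists>c :: real ^ 'n \<Rightarrow> int. axis i 1 = (\<Sum>b\<in>B. of_int (c b) *\<^sub>R b)"
    using lattice_basis_rep[OF B axis_in_int_lattice] by metis
  then obtain e :: "'n \<Rightarrow> real ^ 'n \<Rightarrow> int"
    where e: "\<And>i. axis i 1 = (\<Sum>b\<in>B. of_int (e i b) *\<^sub>R b)"
    by metis
  have "\<forall>b\<in>B. \<forall>i. \<exists>m :: int. b $ i = of_int m"
    using BL by (force simp: int_lattice_def Ints_def)
  then obtain M :: "real ^ 'n \<Rightarrow> 'n \<Rightarrow> int" where M: "\<And>b i. b \<in> B \<Longrightarrow> b $ i = of_int (M b i)"
    by metis
  \<comment> \<open>the integral matrix of \<open>e\<close> is a right inverse of the matrix with rows \<open>B\<close>\<close>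
  have ME: "(\<Sum>i\<in>UNIV. M b' i * e i b) = (if b = b' then 1 else 0)" if "b' \<in> B" "b \<in> B" for b b'
  proof -
    define c where "c b = (\<Sum>i\<in>UNIV. M b' i * e i b) - (if b = b' then 1 else 0)" for b
    have "b' = (\<Sum>i\<in>UNIV. (b' $ i) *\<^sub>R axis i 1)"
      using basis_expansion[of b'] by (simp add: scalar_mult_eq_scaleR)
    also have "\<dots> = (\<Sum>i\<in>UNIV. of_int (M b' i) *\<^sub>R (\<Sum>b\<in>B. of_int (e i b) *\<^sub>R b))"
      using M[OF that(1)] e by simp
    also have "\<dots> = (\<Sum>i\<in>UNIV. \<Sum>b\<in>B. of_int (M b' i * e i b) *\<^sub>R b)"
      by (simp add: scaleR_sum_right)
    also have "\<dots> = (\<Sum>b\<in>B. of_int (\<Sum>i\<in>UNIV. M b' i * e i b) *\<^sub>R b)"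
      by (subst sum.swap) (simp add: scaleR_sum_left)
    finally have b': "b' = (\<Sum>b\<in>B. of_int (\<Sum>i\<in>UNIV. M b' i * e i b) *\<^sub>R b)" .
    have "(\<Sum>b\<in>B. of_int (c b) *\<^sub>R b) =
      (\<Sum>b\<in>B. of_int (\<Sum>i\<in>UNIV. M b' i * e i b) *\<^sub>R b) - (\<Sum>b\<in>B. (if b = b' then b' else 0))"
      unfolding c_def sum_subtractf[symmetric]
      by (intro sum.cong) (auto simp: algebra_simps)
    also have "\<dots> = 0"
      using b' fin that by simp
    finally show ?thesis
      using ind[of c] that by (auto simp: c_def)
  qed
  show indep: "independent B"
  proof (rule independent_if_scalars_zero[OF fin])
    fix f b assume f: "(\<Sum>x\<in>B. f x *\<^sub>R x) = 0" and b: "b \<in> B"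
    have "f b = (\<Sum>x\<in>B. f x * of_int (if b = x then 1 else 0))"
      using b fin by (simp add: if_distrib cong: if_cong)
    also have "\<dots> = (\<Sum>x\<in>B. f x * of_int (\<Sum>i\<in>UNIV. M x i * e i b))"
      using ME b by (intro sum.cong) auto
    also have "\<dots> = (\<Sum>x\<in>B. \<Sum>i\<in>UNIV. (f x * x $ i) * of_int (e i b))"
      using M by (simp add: sum_distrib_left algebra_simps)
    also have "\<dots> = (\<Sum>i\<in>UNIV. (\<Sum>x\<in>B. f x *\<^sub>R x) $ i * of_int (e i b))"
      by (subst sum.swap) (simp add: sum_distrib_right)
    finally show "f b = 0" using f by simp
  qed
  show "card B = CARD('n)"
    using dim_eq_card[of B UNIV] indep lattice_basis_span[OF B] by simp
qed

text \<open>Independence comes for free from counting, since a generating set of the lattice spans.\<close>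

lemma lattice_basisI:
  fixes B :: "(real ^ 'n) set"
  assumes fin: "finite B" and BL: "B \<subseteq> int_lattice" and card: "card B \<le> CARD('n)"
    and gen: "\<And>x. x \<in> int_lattice \<Longrightarrow> \<exists>c :: real ^ 'n \<Rightarrow> int. x = (\<Sum>b\<in>B. of_int (c b) *\<^sub>R b)"
  shows "lattice_basis B"
proof -
  have "x \<in> span B" for x :: "real ^ 'n"
  proof -
    have "axis i 1 \<in> span B" for i
    proof -
      obtain c :: "real ^ 'n \<Rightarrow> int" where "axis i 1 = (\<Sum>b\<in>B. of_int (c b) *\<^sub>R b)"
        using gen[OF axis_in_int_lattice] by blast
      then show ?thesis by (auto intro: span_sum span_mul span_base)
    qed
    then have "(\<Sum>i\<in>UNIV. (x $ i) *\<^sub>R axis i 1) \<in> span B"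
      by (intro span_sum span_mul)
    then show ?thesis
      using basis_expansion[of x] by (simp add: scalar_mult_eq_scaleR)
  qed
  then have "independent B"
    using fin card by (intro card_le_dim_spanning[of B UNIV]) auto
  then have "\<forall>b\<in>B. c b = 0" if "(\<Sum>b\<in>B. of_int (c b) *\<^sub>R b) = 0" for c :: "real ^ 'n \<Rightarrow> int"
    using independentD[of B B "\<lambda>b. of_int (c b)"] fin that by auto
  then show ?thesis
    using fin BL gen by (auto simp: lattice_basis_def)
qed

text \<open>
  The ray through a lattice point leaves the polytope in a facet. The resulting nonnegative
  coordinates are integral, since they agree up to scaling with the coordinates in the lattice basis.
\<close>

lemma lattice_point_in_facet_cone:
  fixes P :: "(real ^ 'n) set"
  assumes P: "smooth_fano P" and x: "x \<in> int_lattice" "x \<noteq> 0"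
  obtains a and c :: "real ^ 'n \<Rightarrow> int"
    where "facet_normal P a" "x = (\<Sum>b\<in>tight P a. of_int (c b) *\<^sub>R b)"
      "\<And>b. b \<in> tight P a \<Longrightarrow> 0 \<le> c b"
proof -
  note P' = smooth_fanoD[OF P]
  have "bounded P" using P'(1) polytope_imp_bounded by blast
  then obtain d where d: "0 < d" "0 + d *\<^sub>R x \<in> frontier P"
    using ray_to_frontier[of P 0 x] P'(2) x(2) by metis
  have "frontier P = rel_frontier P"
    using P'(2) by (intro rel_frontier_nonempty_interior[symmetric]) auto
  then have "d *\<^sub>R x \<in> \<Union>{F. F facet_of P}"
    using d(2) rel_frontier_of_polyhedron[OF polytope_imp_polyhedron[OF P'(1)]] by auto
  then obtain a where a: "facet_normal P a" and dx: "d *\<^sub>R x \<in> P \<inter> {x. a \<bullet> x = 1}"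
    using facet_of_iff_facet_normal[OF P'(1,2)] by blast
  define T where "T = tight P a"
  have T: "lattice_basis T" using P'(5)[OF a] by (simp add: T_def)
  have finT: "finite T" using T by (simp add: lattice_basis_def)
  have face: "(P \<inter> {x. a \<bullet> x = 1}) face_of P"
    using a facet_of_iff_facet_normal[OF P'(1,2)] facet_of_imp_face_of by blast
  then have "polytope (P \<inter> {x. a \<bullet> x = 1})"
    using P'(1) face_of_polytope_polytope by blast
  then have "d *\<^sub>R x \<in> convex hull T"
    using polytope_eq_hull_vertices vertices_facet[OF P'(1) a] dx by (metis T_def)
  then obtain u where u: "\<And>b. b \<in> T \<Longrightarrow> 0 \<le> u b" "(\<Sum>b\<in>T. u b *\<^sub>R b) = d *\<^sub>R x"
    using convex_hull_finite[OF finT] by auto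
  obtain c :: "real ^ 'n \<Rightarrow> int" where c: "x = (\<Sum>b\<in>T. of_int (c b) *\<^sub>R b)"
    using lattice_basis_rep[OF T x(1)] by blast
  have "(\<Sum>b\<in>T. (d * of_int (c b) - u b) *\<^sub>R b) = d *\<^sub>R x - d *\<^sub>R x"
    using u(2) by (subst (1) c) (simp add: scaleR_sum_right sum_subtractf scaleR_left_diff_distrib)
  then have "d * of_int (c b) - u b = 0" if "b \<in> T" for b
    using independentD[OF lattice_basis_card_independent(2)[OF T] finT subset_refl _ that,
      of "\<lambda>b. d * of_int (c b) - u b"] by simp
  then have "d * of_int (c b) = u b" if "b \<in> T" for b
    using that by fastforce
  then have "0 \<le> d * of_int (c b)" if "b \<in> T" for b
    using u(1) that by metis
  then have "0 \<le> c b" if "b \<in> T" for b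
    using d(1) that by (simp add: zero_le_mult_iff)
  then show thesis
    using that[OF a] c by (simp add: T_def)
qed

lemma inner_int_combination:
  fixes a :: "real ^ 'n"
  assumes "finite B" "x = (\<Sum>b\<in>B. of_int (c b) *\<^sub>R b)"
  shows "a \<bullet> x = (\<Sum>b\<in>B. of_int (c b) * (a \<bullet> b))"
  using assms by (simp add: inner_sum_right)

lemma inner_tight_combination:
  fixes P :: "(real ^ 'n) set" and c :: "real ^ 'n \<Rightarrow> int"
  assumes "x = (\<Sum>b\<in>tight P a. of_int (c b) *\<^sub>R b)"
  shows "a \<bullet> x = of_int (\<Sum>b\<in>tight P a. c b)"
  by (subst assms) (auto simp: inner_sum_right tight_def)

lemma facet_normal_pos:
  fixes P :: "(real ^ 'n) set"
  assumes P: "smooth_fano P" and x: "x \<in> int_lattice" "x \<noteq> 0"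
  obtains a where "facet_normal P a" "a \<bullet> x \<ge> 1"
proof -
  obtain a and c :: "real ^ 'n \<Rightarrow> int"
    where a: "facet_normal P a" and c: "x = (\<Sum>b\<in>tight P a. of_int (c b) *\<^sub>R b)"
      "\<And>b. b \<in> tight P a \<Longrightarrow> 0 \<le> c b"
    using lattice_point_in_facet_cone[OF P x] by metis
  have fin: "finite (tight P a)"
    using smooth_fanoD(4)[OF P] finite_subset[OF tight_subset] by blast
  have "(\<Sum>b\<in>tight P a. c b) \<noteq> 0"
    using sum_nonneg_eq_0_iff[OF fin, of c] c x(2) by auto
  then have "(\<Sum>b\<in>tight P a. c b) \<ge> 1"
    using sum_nonneg[of "tight P a" c] c(2) by force
  then have "a \<bullet> x \<ge> 1"
    using inner_tight_combination[OF c(1)] by linarith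
  then show thesis using that a by blast
qed

text \<open>
  Nonzero lattice points have height at least one over some facet, so none of them is interior.
\<close>

lemma interior_lattice_point:
  fixes P :: "(real ^ 'n) set"
  assumes P: "smooth_fano P" and x: "x \<in> int_lattice" "x \<in> interior P"
  shows "x = 0"
proof (rule ccontr)
  assume "x \<noteq> 0"
  then obtain a where a: "facet_normal P a" "a \<bullet> x \<ge> 1"
    using facet_normal_pos[OF P x(1)] by metis
  then have "a \<noteq> 0" by auto
  have "P \<subseteq> {x. a \<bullet> x \<le> 1}"
    using polytope_normal_le[OF smooth_fanoD(1)[OF P]] a(1) by (auto simp: facet_normal_def)
  then have "x \<in> interior {x. a \<bullet> x \<le> 1}"
    using x(2) interior_mono by blast
  then show False using a(2) \<open>a \<noteq> 0\<close> by simp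
qed

text \<open>
  A lattice point that is no vertex has height at least two over the facet whose cone contains it:
  at height one it would be a single vertex, because its coordinates are natural numbers.
\<close>

lemma non_vertex_height:
  fixes P :: "(real ^ 'n) set"
  assumes P: "smooth_fano P" and x: "x \<in> int_lattice" "x \<noteq> 0" "x \<notin> vertices P"
  obtains a where "facet_normal P a" "a \<bullet> x \<ge> 2"
proof -
  obtain a and c :: "real ^ 'n \<Rightarrow> int"
    where a: "facet_normal P a" and c: "x = (\<Sum>b\<in>tight P a. of_int (c b) *\<^sub>R b)"
      "\<And>b. b \<in> tight P a \<Longrightarrow> 0 \<le> c b"
    using lattice_point_in_facet_cone[OF P x(1,2)] by metis
  have fin: "finite (tight P a)"
    using smooth_fanoD(4)[OF P] finite_subset[OF tight_subset] by blast
  have s0: "(\<Sum>b\<in>tight P a. c b) \<noteq> 0"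
    using sum_nonneg_eq_0_iff[OF fin, of c] c x(2) by auto
  have "(\<Sum>b\<in>tight P a. c b) \<noteq> 1"
  proof
    assume 1: "(\<Sum>b\<in>tight P a. c b) = 1"
    obtain b where b: "b \<in> tight P a" "c b \<noteq> 0"
      using s0 by (meson sum.neutral)
    then have cb: "c b \<ge> 1" using c(2)[of b] by linarith
    have r: "(\<Sum>b\<in>tight P a. c b) = c b + (\<Sum>b'\<in>tight P a - {b}. c b')"
      using b fin by (simp add: sum.remove)
    have nn: "(\<Sum>b'\<in>tight P a - {b}. c b') \<ge> 0"
      using c(2) by (intro sum_nonneg) auto
    have z: "(\<Sum>b'\<in>tight P a - {b}. c b') = 0" and cb1: "c b = 1"
      using r nn cb 1 by linarith+
    then have "\<forall>b'\<in>tight P a - {b}. c b' = 0"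
      using sum_nonneg_eq_0_iff[of "tight P a - {b}" c] fin c(2) by auto
    then have "(\<Sum>b\<in>tight P a. of_int (c b) *\<^sub>R b) = b"
      using b fin cb1 by (simp add: sum.remove)
    then show False using c(1) b x(3) by (auto simp: tight_def)
  qed
  then have "(\<Sum>b\<in>tight P a. c b) \<ge> 2"
    using s0 sum_nonneg[of "tight P a" c] c(2) by force
  then have "a \<bullet> x \<ge> 2"
    using inner_tight_combination[OF c(1)] by linarith
  then show thesis using that a by blast
qed

section \<open>Unimodular equivalence and isolation\<close>

definition lattice_automorphism :: "(real ^ 'n \<Rightarrow> real ^ 'n) \<Rightarrow> bool" where
  "lattice_automorphism g \<longleftrightarrow> linear g \<and> g ` int_lattice = int_lattice"

lemma span_int_lattice: "span (int_lattice :: (real ^ 'n) set) = UNIV"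
proof -
  have "x \<in> span int_lattice" for x :: "real ^ 'n"
  proof -
    have "(\<Sum>i\<in>UNIV. (x $ i) *\<^sub>R axis i 1) \<in> span int_lattice"
      by (intro span_sum span_mul span_base axis_in_int_lattice)
    then show ?thesis
      using basis_expansion[of x] by (simp add: scalar_mult_eq_scaleR)
  qed
  then show ?thesis by auto
qed

lemma lattice_automorphism_bij:
  fixes g :: "real ^ 'n \<Rightarrow> real ^ 'n"
  assumes "lattice_automorphism g"
  shows "inj g" "surj g" "bij g"
proof -
  have lin: "linear g" using assms by (simp add: lattice_automorphism_def)
  have "range g = g ` span int_lattice" by (simp add: span_int_lattice)
  also have "\<dots> = span (g ` int_lattice)" using lin by (simp add: linear_span_image)
  also have "\<dots> = UNIV" using assms by (simp add: lattice_automorphism_def span_int_lattice)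
  finally show s: "surj g" .
  then show i: "inj g" using lin linear_surjective_imp_injective by blast
  show "bij g" using s i by (simp add: bij_def)
qed

lemma lattice_automorphism_inv:
  fixes g :: "real ^ 'n \<Rightarrow> real ^ 'n"
  assumes g: "lattice_automorphism g"
  shows "lattice_automorphism (inv g)"
proof -
  have "inv g ` int_lattice = inv g ` g ` int_lattice"
    using g by (simp add: lattice_automorphism_def)
  also have "\<dots> = int_lattice"
    using lattice_automorphism_bij(1)[OF g] by (simp add: image_inv_f_f)
  finally show ?thesis
    using g lattice_automorphism_bij(1)[OF g] inj_linear_imp_inv_linear
    by (auto simp: lattice_automorphism_def)
qed

lemma vertices_linear_image:
  fixes g :: "real ^ 'n \<Rightarrow> real ^ 'n"
  assumes "linear g" "bij g"
  shows "vertices (g ` P) = g ` vertices P"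
proof -
  have "g v extreme_point_of g ` P \<longleftrightarrow> v extreme_point_of P" for v
    using face_of_linear_image[of g "{v}" P] assms
    by (simp add: face_of_singleton[symmetric] bij_is_inj del: face_of_singleton)
  then show ?thesis
    using assms(2) unfolding vertices_def by (auto simp: image_iff) (metis bij_pointE)
qed

lemma lattice_basis_image:
  fixes g :: "real ^ 'n \<Rightarrow> real ^ 'n"
  assumes g: "lattice_automorphism g" and B: "lattice_basis B"
  shows "lattice_basis (g ` B)"
proof (rule lattice_basisI)
  have lin: "linear g" and inj: "inj g"
    using g lattice_automorphism_bij(1)[OF g] by (auto simp: lattice_automorphism_def)
  show "finite (g ` B)" using B by (simp add: lattice_basis_def)
  show "g ` B \<subseteq> int_lattice"
    using B g by (auto simp: lattice_basis_def lattice_automorphism_def)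
  show "card (g ` B) \<le> CARD('n)"
    using lattice_basis_card_independent(1)[OF B] inj
    by (simp add: card_image inj_on_subset[OF inj])
  fix x :: "real ^ 'n" assume "x \<in> int_lattice"
  then obtain y where y: "y \<in> int_lattice" "x = g y"
    using g by (auto simp: lattice_automorphism_def)
  obtain c :: "real ^ 'n \<Rightarrow> int" where c: "y = (\<Sum>b\<in>B. of_int (c b) *\<^sub>R b)"
    using lattice_basis_rep[OF B y(1)] by blast
  have "x = (\<Sum>b\<in>B. of_int (c b) *\<^sub>R g b)"
    unfolding y(2) by (subst c) (simp add: linear_sum[OF lin] linear_cmul[OF lin])
  also have "\<dots> = (\<Sum>b\<in>g ` B. of_int (c (inv g b)) *\<^sub>R b)"
    using inj by (simp add: sum.reindex inj_on_subset[OF inj])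
  finally show "\<exists>c :: real ^ 'n \<Rightarrow> int. x = (\<Sum>b\<in>g ` B. of_int (c b) *\<^sub>R b)"
    by (rule exI[of _ "\<lambda>b. c (inv g b)"])
qed

text \<open>
  The facet normals of the image are the preimages of facet normals under the adjoint map.
\<close>

lemma smooth_fano_image:
  fixes g :: "real ^ 'n \<Rightarrow> real ^ 'n"
  assumes g: "lattice_automorphism g" and P: "smooth_fano P"
  shows "smooth_fano (g ` P)"
proof -
  have lin: "linear g" and bij: "bij g" and inj: "inj g"
    using g lattice_automorphism_bij[OF g] by (auto simp: lattice_automorphism_def)
  note V = vertices_linear_image[OF lin bij]
  have adj: "a \<bullet> g x = adjoint g a \<bullet> x" for a x
    using adjoint_works[OF lin, of x a] by (simp add: inner_commute)
  have t: "tight (g ` P) a = g ` tight P (adjoint g a)" for a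
    by (auto simp: tight_def V adj)
  have "facet_normal P (adjoint g a)" if "facet_normal (g ` P) a" for a
  proof -
    have "g ` span (tight P (adjoint g a)) = UNIV"
      using that t lin by (simp add: facet_normal_def linear_span_image)
    then have "span (tight P (adjoint g a)) = UNIV"
      using inj by (metis inj_image_eq_iff bij bij_is_surj)
    then show ?thesis
      using that by (auto simp: facet_normal_def V adj)
  qed
  then have "lattice_basis (tight (g ` P) a)" if "facet_normal (g ` P) a" for a
    using that smooth_fanoD(5)[OF P] lattice_basis_image[OF g] t by metis
  moreover have "0 \<in> interior (g ` P)"
    using smooth_fanoD(2)[OF P] interior_injective_linear_image[OF lin inj, of P] linear_0[OF lin]
    by (metis imageI)
  moreover have "vertices (g ` P) \<subseteq> int_lattice"
    using smooth_fanoD(3)[OF P] g image_mono[of "vertices P" int_lattice g]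
    by (simp add: V lattice_automorphism_def)
  ultimately show ?thesis
    using smooth_fanoD(1)[OF P] polytope_linear_image[OF lin] by (auto simp: smooth_fano_iff)
qed

text \<open>
  The origin is the only interior lattice point of a smooth Fano polytope, so a unimodular
  equivalence between two of them has no translation part.
\<close>

lemma unimodularly_equivalent_linear:
  fixes P :: "(real ^ 'n) set"
  assumes P: "smooth_fano P" and Q: "smooth_fano Q" and PQ: "unimodularly_equivalent P Q"
  obtains g where "lattice_automorphism g" "g ` P = Q"
proof -
  obtain f a where lin: "linear f"
    and L: "(\<lambda>x. f x + a) ` int_lattice = int_lattice" and im: "(\<lambda>x. f x + a) ` P = Q"
    using PQ by (auto simp: unimodularly_equivalent_def affine_map_def)
  have add: "x + y \<in> int_lattice" and diff: "x - y \<in> int_lattice"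
    if "x \<in> int_lattice" "y \<in> int_lattice" for x y :: "real ^ 'n"
    using that by (auto simp: int_lattice_def)
  have "(0 :: real ^ 'n) \<in> int_lattice" by (simp add: int_lattice_def)
  then have a: "a \<in> int_lattice"
    using L linear_0[OF lin] by (metis (mono_tags, lifting) add_0 imageI)
  have "f ` int_lattice = int_lattice"
  proof
    show "f ` int_lattice \<subseteq> int_lattice"
    proof
      fix y assume "y \<in> f ` int_lattice"
      then obtain x where x: "x \<in> int_lattice" "y = f x" by blast
      then have "f x + a \<in> int_lattice" using L by blast
      from diff[OF this a] x show "y \<in> int_lattice" by simp
    qed
    show "int_lattice \<subseteq> f ` int_lattice"
    proof
      fix y :: "real ^ 'n" assume "y \<in> int_lattice"
      then have "y + a \<in> (\<lambda>x. f x + a) ` int_lattice" using add a L by blast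
      then show "y \<in> f ` int_lattice" by auto
    qed
  qed
  then have g: "lattice_automorphism f" using lin by (simp add: lattice_automorphism_def)
  have imQ: "Q = (\<lambda>x. a + x) ` f ` P"
    using im by (simp add: image_image add.commute)
  have "0 \<in> interior (f ` P)"
    using smooth_fanoD(2)[OF smooth_fano_image[OF g P]] .
  then have "a \<in> interior Q"
    unfolding imQ interior_translation by force
  then have "a = 0"
    using interior_lattice_point[OF Q a] by simp
  then show thesis using that[OF g] im by simp
qed

lemma unimodularly_equivalentI:
  "lattice_automorphism g \<Longrightarrow> unimodularly_equivalent P (g ` P)"
  unfolding unimodularly_equivalent_def affine_map_def lattice_automorphism_def
  by (intro exI[of _ g]) force

lemma adds_vertex_image:
  fixes g :: "real ^ 'n \<Rightarrow> real ^ 'n"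
  assumes g: "lattice_automorphism g" and PQ: "adds_vertex P Q"
  shows "adds_vertex (g ` P) (g ` Q)"
proof -
  have lin: "linear g" using g by (simp add: lattice_automorphism_def)
  note bij = lattice_automorphism_bij[OF g]
  obtain w where w: "w \<in> int_lattice" "w \<notin> vertices P" "vertices Q = vertices P \<union> {w}"
    using PQ by (auto simp: adds_vertex_def)
  have "g w \<in> int_lattice" using w g by (auto simp: lattice_automorphism_def)
  moreover have "g w \<notin> vertices (g ` P)" "vertices (g ` Q) = vertices (g ` P) \<union> {g w}"
    using w bij(1) by (auto simp: vertices_linear_image[OF lin bij(3)] inj_image_mem_iff)
  ultimately show ?thesis by (auto simp: adds_vertex_def)
qed

text \<open>
  A chain witnessing I-equivalence to \<open>P\<close> can be moved by a lattice automorphism so that it ends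
  in \<open>P\<close> itself; when \<open>P\<close> has no neighbour, the chain has length zero.
\<close>

lemma I_isolatedI:
  fixes P :: "(real ^ 'n) set"
  assumes P: "smooth_fano P"
    and nb: "\<And>Q. smooth_fano Q \<Longrightarrow> \<not> adds_vertex P Q \<and> \<not> adds_vertex Q P"
  shows "I_isolated P"
  unfolding I_isolated_def
proof (intro conjI allI impI, rule P)
  fix P' :: "(real ^ 'n) set" assume "smooth_fano P' \<and> I_equivalent P' P"
  then obtain k and R :: "nat \<Rightarrow> (real ^ 'n) set" where P': "smooth_fano P'"
    and R: "\<And>i. i \<le> k \<Longrightarrow> smooth_fano (R i)"
    and R0: "unimodularly_equivalent P' (R 0)" and Rk: "unimodularly_equivalent P (R k)"
    and step: "\<And>i. i \<in> {1..k} \<Longrightarrow> adds_vertex (R (i - 1)) (R i) \<or> adds_vertex (R i) (R (i - 1))"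
    unfolding I_equivalent_def by blast
  obtain g where g: "lattice_automorphism g" "g ` P = R k"
    using unimodularly_equivalent_linear[OF P R Rk] by blast
  define h where "h = inv g"
  have h: "lattice_automorphism h" "h ` R k = P"
    using lattice_automorphism_inv[OF g(1)] g lattice_automorphism_bij(1)[OF g(1)]
    by (auto simp: h_def image_inv_f_f simp flip: g(2))
  have "k = 0"
  proof (rule ccontr)
    assume "k \<noteq> 0"
    then have "adds_vertex (h ` R (k - 1)) P \<or> adds_vertex P (h ` R (k - 1))"
      using step[of k] adds_vertex_image[OF h(1)] h(2) by fastforce
    then show False
      using nb[OF smooth_fano_image[OF h(1) R[of "k - 1"]]] by auto
  qed
  obtain f where f: "lattice_automorphism f" "f ` P' = R 0"
    using unimodularly_equivalent_linear[OF P' R R0] by blast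
  have "lattice_automorphism (h \<circ> f)"
    using f(1) h(1) linear_compose[of f h]
    unfolding lattice_automorphism_def image_comp[symmetric] by simp
  moreover have "(h \<circ> f) ` P' = P"
    unfolding image_comp[symmetric] using f(2) h(2) \<open>k = 0\<close> by simp
  ultimately show "unimodularly_equivalent P' P"
    using unimodularly_equivalentI by metis
qed

section \<open>Constructing and enlarging smooth Fano polytopes\<close>

text \<open>
  If the origin is not an interior point, then either the hull lies in a hyperplane or the origin
  can be separated from its interior; both give a nonzero functional that is nowhere positive.
\<close>

lemma zero_in_interior_hull:
  fixes W :: "(real ^ 'n) set"
  assumes "\<And>a. (\<forall>w\<in>W. a \<bullet> w \<le> 0) \<Longrightarrow> a = 0"
  shows "0 \<in> interior (convex hull W)"
proof (rule ccontr)
  let ?P = "convex hull W"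
  assume n: "0 \<notin> interior ?P"
  have "\<exists>a. a \<noteq> 0 \<and> (\<forall>x\<in>?P. a \<bullet> x \<le> 0)"
  proof (cases "interior ?P = {}")
    case True
    then obtain a b where ab: "a \<noteq> 0" "?P \<subseteq> {x. a \<bullet> x = b}"
      using empty_interior_subset_hyperplane[OF convex_convex_hull] by metis
    show ?thesis
    proof (cases "b \<le> 0")
      case True
      then show ?thesis using ab by (intro exI[of _ a]) auto
    next
      case False
      then show ?thesis using ab by (intro exI[of _ "- a"]) auto
    qed
  next
    case False
    have "convex (interior ?P)" by (intro convex_interior convex_convex_hull)
    then obtain a where a: "a \<noteq> 0" "\<forall>x\<in>interior ?P. 0 \<le> a \<bullet> x"
      using separating_hyperplane_set_0 n by blast
    have "closure (interior ?P) \<subseteq> {x. 0 \<le> a \<bullet> x}"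
      using a(2) by (intro closure_minimal closed_halfspace_ge) auto
    moreover have "?P \<subseteq> closure (interior ?P)"
      using convex_closure_interior[OF convex_convex_hull False] closure_subset by blast
    ultimately show ?thesis
      using a(1) by (intro exI[of _ "- a"]) auto
  qed
  then show False
    using assms hull_subset[of W convex] by blast
qed

text \<open>
  The condition \<open>vert\<close> makes every point of \<open>W\<close> a vertex: it is a vertex of the simplex that the
  hyperplane \<open>a \<bullet> x = 1\<close> cuts out of the hull.
\<close>

lemma smooth_fano_hull:
  fixes W :: "(real ^ 'n) set"
  assumes fin: "finite W" and WL: "W \<subseteq> int_lattice"
    and pos: "\<And>a. (\<forall>w\<in>W. a \<bullet> w \<le> 0) \<Longrightarrow> a = 0"
    and vert: "\<And>w. w \<in> W \<Longrightarrow> \<exists>a. (\<forall>v\<in>W. a \<bullet> v \<le> 1) \<and> a \<bullet> w = 1 \<and> independent {v \<in> W. a \<bullet> v = 1}"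
    and facets: "\<And>a. (\<forall>v\<in>W. a \<bullet> v \<le> 1) \<Longrightarrow> span {v \<in> W. a \<bullet> v = 1} = UNIV \<Longrightarrow>
      lattice_basis {v \<in> W. a \<bullet> v = 1}"
  shows "smooth_fano (convex hull W)" "vertices (convex hull W) = W"
proof -
  let ?P = "convex hull W"
  show V: "vertices ?P = W"
  proof
    show "vertices ?P \<subseteq> W" by (auto simp: vertices_def extreme_point_of_convex_hull)
    show "W \<subseteq> vertices ?P"
    proof
      fix w assume w: "w \<in> W"
      then obtain a where a: "\<forall>v\<in>W. a \<bullet> v \<le> 1" "a \<bullet> w = 1" "independent {v \<in> W. a \<bullet> v = 1}"
        using vert by blast
      let ?T = "{v \<in> W. a \<bullet> v = 1}" and ?F = "?P \<inter> {x. a \<bullet> x = 1}"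
      have "?P \<subseteq> {x. a \<bullet> x \<le> 1}"
        using a(1) by (intro hull_minimal convex_halfspace_le) auto
      then have face: "?F face_of ?P"
        by (intro face_of_Int_supporting_hyperplane_le convex_convex_hull) auto
      obtain S where S: "S \<subseteq> W" "?F = convex hull S"
        using face_of_convex_hull_subset[OF finite_imp_compact[OF fin] face] by blast
      have "S \<subseteq> ?T" using S hull_subset[of S convex] by auto
      then have "?F \<subseteq> convex hull ?T" using S(2) hull_mono by metis
      moreover have "convex hull ?T \<subseteq> ?F"
        using hull_subset[of W convex]
        by (intro hull_minimal convex_Int convex_convex_hull convex_hyperplane) auto
      ultimately have F: "?F = convex hull ?T" by blast
      have "\<not> affine_dependent ?T"
        using a(3) affine_dependent_imp_dependent by blast
      then have "w extreme_point_of ?F"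
        using extreme_point_of_convex_hull_affine_independent F a(2) w by auto
      then show "w \<in> vertices ?P"
        using extreme_point_of_face[OF face] by (simp add: vertices_def)
    qed
  qed
  show "smooth_fano ?P"
    using zero_in_interior_hull[OF pos] fin WL facets
    by (auto simp: smooth_fano_iff V facet_normal_def tight_def polytope_convex_hull)
qed

text \<open>
  If a functional vanishes on a lattice basis except at \<open>w\<close> and equals one at a lattice point, then
  its value at \<open>w\<close> divides one.
\<close>

lemma lattice_basis_exchange_unit:
  fixes B :: "(real ^ 'n) set"
  assumes B: "lattice_basis B" and x: "x \<in> int_lattice"
    and \<xi>: "\<And>b. b \<in> B \<Longrightarrow> b \<noteq> w \<Longrightarrow> \<xi> \<bullet> b = 0" and w: "w \<in> B" and \<xi>x: "\<xi> \<bullet> x = 1"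
  obtains m :: int where "of_int m * (\<xi> \<bullet> w) = 1"
proof -
  have fin: "finite B" using B by (simp add: lattice_basis_def)
  obtain c :: "real ^ 'n \<Rightarrow> int" where c: "x = (\<Sum>b\<in>B. of_int (c b) *\<^sub>R b)"
    using lattice_basis_rep[OF B x] by blast
  have "1 = (\<Sum>b\<in>B. of_int (c b) * (\<xi> \<bullet> b))"
    using inner_int_combination[OF fin c, of \<xi>] \<xi>x by simp
  also have "\<dots> = of_int (c w) * (\<xi> \<bullet> w)"
    using \<xi> w fin by (subst sum.remove[of _ w]) auto
  finally show thesis using that[of "c w"] by simp
qed

text \<open>
  Let \<open>Q\<close> arise from \<open>P\<close> by adding the vertex \<open>w\<close>, and let \<open>a\<close>, \<open>a'\<close> be normals of adjacent
  facets of \<open>P\<close>, the first of which is visible from \<open>w\<close> while the second is not. Then their common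
  ridge together with \<open>w\<close> is a facet of \<open>Q\<close>: its normal is the convex combination of \<open>a\<close> and
  \<open>a'\<close> that equals one at \<open>w\<close>. As this facet and the facet of \<open>a\<close> are lattice bases that differ in
  a single element, \<open>w\<close> has coefficient one at the exchanged vertex \<open>x\<close>, which fixes the
  difference of the heights of \<open>w\<close>.
\<close>

lemma horizon_height_difference:
  fixes P Q :: "(real ^ 'n) set"
  assumes P: "smooth_fano P" and Q: "smooth_fano Q"
    and VQ: "vertices Q = insert w (vertices P)" and w: "w \<notin> vertices P" "w \<in> int_lattice"
    and a: "facet_normal P a" and a': "facet_normal P a'"
    and x: "x \<in> tight P a" "x \<notin> tight P a'" and ridge: "tight P a - {x} \<subseteq> tight P a'"
    and vis: "a \<bullet> w > 0" and nvis: "a' \<bullet> w \<le> 0"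
  shows "a \<bullet> w - a' \<bullet> w = 1 - a' \<bullet> x" "a \<bullet> w \<ge> 2"
proof -
  define T where "T = tight P a"
  have T: "lattice_basis T" using smooth_fanoD(5)[OF P a] by (simp add: T_def)
  have finT: "finite T" using T by (simp add: lattice_basis_def)
  have cardT: "card T = CARD('n)" using lattice_basis_card_independent(1)[OF T] .
  have xT: "x \<in> T" using x by (simp add: T_def)
  have xV: "x \<in> vertices P" using x tight_subset by blast
  obtain c :: "real ^ 'n \<Rightarrow> int" where c: "w = (\<Sum>b\<in>T. of_int (c b) *\<^sub>R b)"
    using lattice_basis_rep[OF T w(2)] by blast
  have a1: "a \<bullet> b = 1" if "b \<in> T" for b using that by (simp add: T_def tight_def)
  have a'1: "a' \<bullet> b = 1" if "b \<in> T - {x}" for b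
    using that ridge by (auto simp: T_def tight_def)
  have ax: "a \<bullet> x = 1" using a1 xT by simp
  have a'x: "a' \<bullet> x < 1"
    using facet_normal_le[OF a' xV] x(2) xV by (auto simp: tight_def)
  have aw: "a \<bullet> w = of_int (\<Sum>b\<in>T. c b)"
    using inner_tight_combination[OF c[unfolded T_def]] by (simp add: T_def)
  \<comment> \<open>the coordinate at \<open>x\<close> with respect to the basis \<open>T\<close>\<close>
  define \<xi> where "\<xi> = (a - a') /\<^sub>R (1 - a' \<bullet> x)"
  have \<xi>x: "\<xi> \<bullet> x = 1" using a'x ax by (simp add: \<xi>_def inner_diff_left)
  have \<xi>0: "\<xi> \<bullet> b = 0" if "b \<in> T - {x}" for b
    using a1 a'1 that by (simp add: \<xi>_def inner_diff_left)
  have "\<xi> \<bullet> w = (\<Sum>b\<in>T. of_int (c b) * (\<xi> \<bullet> b))"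
    using inner_int_combination[OF finT c] .
  also have "\<dots> = of_int (c x)"
    using \<xi>0 \<xi>x xT finT by (subst sum.remove[of _ x]) auto
  finally have \<xi>w: "\<xi> \<bullet> w = of_int (c x)" .
  have "\<xi> \<bullet> w = (a \<bullet> w - a' \<bullet> w) / (1 - a' \<bullet> x)"
    by (simp add: \<xi>_def inner_diff_left divide_inverse mult.commute)
  then have diff: "a \<bullet> w - a' \<bullet> w = of_int (c x) * (1 - a' \<bullet> x)"
    using a'x \<xi>w by simp
  have "0 < of_int (c x) * (1 - a' \<bullet> x)"
    using diff vis nvis by simp
  then have cx: "c x > 0"
    using a'x by (simp add: zero_less_mult_iff)
  \<comment> \<open>height one would make \<open>w\<close> an additional vertex of a facet that is already a simplex\<close>
  have "a \<bullet> w \<noteq> 1"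
  proof
    assume "a \<bullet> w = 1"
    then have tQ: "tight Q a = insert w T"
      using VQ by (auto simp: tight_def T_def)
    then have "facet_normal Q a"
      using a VQ \<open>a \<bullet> w = 1\<close> span_mono[of T "insert w T"]
      by (auto simp: facet_normal_def T_def)
    then have "card (insert w T) = CARD('n)"
      using smooth_fanoD(5)[OF Q] lattice_basis_card_independent(1) tQ by metis
    moreover have "w \<notin> T" using w tight_subset by (auto simp: T_def)
    ultimately show False using cardT finT by simp
  qed
  then have "(\<Sum>b\<in>T. c b) > 0" "(\<Sum>b\<in>T. c b) \<noteq> 1"
    using vis unfolding aw of_int_0_less_iff of_int_eq_1_iff by simp_all
  then have "(\<Sum>b\<in>T. c b) \<ge> 2" by linarith
  then show aw2: "a \<bullet> w \<ge> 2"
    unfolding aw by linarith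
  \<comment> \<open>tilting \<open>a'\<close> towards \<open>a\<close> about the common ridge until the hyperplane meets \<open>w\<close>\<close>
  define \<mu> where "\<mu> = (1 - a' \<bullet> w) / (a \<bullet> w - a' \<bullet> w)"
  have \<mu>: "0 < \<mu>" "\<mu> < 1" using aw2 nvis by (auto simp: \<mu>_def field_simps)
  define g where "g = (1 - \<mu>) *\<^sub>R a' + \<mu> *\<^sub>R a"
  have g: "g \<bullet> y = (1 - \<mu>) * (a' \<bullet> y) + \<mu> * (a \<bullet> y)" for y
    by (simp add: g_def inner_add_left)
  have "g \<bullet> w = a' \<bullet> w + \<mu> * (a \<bullet> w - a' \<bullet> w)"
    by (simp add: g algebra_simps)
  also have "\<dots> = 1"
    using aw2 nvis by (simp add: \<mu>_def)
  finally have gw: "g \<bullet> w = 1" .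
  have gle: "g \<bullet> v \<le> 1" if "v \<in> vertices P" for v
    using convex_bound_le[OF facet_normal_le[OF a' that] facet_normal_le[OF a that], of "1 - \<mu>" \<mu>] \<mu>
    by (simp add: g)
  have gx: "g \<bullet> x < 1"
  proof -
    have "(1 - \<mu>) * (a' \<bullet> x) < 1 - \<mu>" using a'x \<mu> by simp
    then show ?thesis by (simp add: g ax)
  qed
  have sub: "insert w (T - {x}) \<subseteq> tight Q g"
  proof
    fix b assume "b \<in> insert w (T - {x})"
    then consider "b = w" | "b \<in> T - {x}" by blast
    then show "b \<in> tight Q g"
    proof cases
      case 1
      then show ?thesis using gw VQ by (simp add: tight_def)
    next
      case 2
      then have "g \<bullet> b = 1" using a1[of b] a'1[of b] by (simp add: g)
      moreover have "b \<in> vertices P" using 2 tight_subset by (auto simp: T_def)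
      ultimately show ?thesis using VQ by (simp add: tight_def)
    qed
  qed
  have "x \<in> span (insert w (T - {x}))"
  proof -
    have "w = of_int (c x) *\<^sub>R x + (\<Sum>b\<in>T - {x}. of_int (c b) *\<^sub>R b)"
      using c xT finT by (simp add: sum.remove)
    then have "x = (1 / of_int (c x)) *\<^sub>R (w - (\<Sum>b\<in>T - {x}. of_int (c b) *\<^sub>R b))"
      using cx by simp
    moreover have "(1 / of_int (c x)) *\<^sub>R (w - (\<Sum>b\<in>T - {x}. of_int (c b) *\<^sub>R b)) \<in> span (insert w (T - {x}))"
      by (intro span_mul span_diff span_sum span_base) auto
    ultimately show ?thesis by metis
  qed
  then have "T \<subseteq> span (insert w (T - {x}))"
    by (auto intro: span_base)
  then have "span T \<subseteq> span (tight Q g)"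
    using sub by (meson span_minimal span_mono subspace_span subset_trans)
  then have gN: "facet_normal Q g"
    using gle gw VQ lattice_basis_span[OF T] by (auto simp: facet_normal_def)
  have B: "lattice_basis (tight Q g)" using smooth_fanoD(5)[OF Q gN] .
  have "card (insert w (T - {x})) = CARD('n)"
  proof -
    have "w \<notin> T - {x}" using w tight_subset by (auto simp: T_def)
    moreover have "card (T - {x}) = CARD('n) - 1"
      using finT xT cardT by simp
    ultimately show ?thesis
      using finT by simp
  qed
  then have eq: "insert w (T - {x}) = tight Q g"
    using sub B lattice_basis_card_independent(1)[OF B]
    by (intro card_subset_eq) (auto simp: lattice_basis_def)
  obtain m :: int where "of_int m * (\<xi> \<bullet> w) = 1"
  proof (rule lattice_basis_exchange_unit[OF B _ _ _ \<xi>x])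
    show "x \<in> int_lattice" using xV smooth_fanoD(3)[OF P] by blast
    show "\<xi> \<bullet> b = 0" if "b \<in> tight Q g" "b \<noteq> w" for b
      using that eq \<xi>0 by blast
    show "w \<in> tight Q g" using eq by blast
  qed blast
  then have "m * c x = 1"
    using \<xi>w by (metis of_int_eq_1_iff of_int_mult)
  then have "c x = 1"
    using cx zmult_eq_1_iff by auto
  then show "a \<bullet> w - a' \<bullet> w = 1 - a' \<bullet> x"
    using diff by simp
qed

section \<open>Labels, relations and facet functionals\<close>

definition add_subgroup :: "'a::ab_group_add set \<Rightarrow> bool" where
  "add_subgroup G \<longleftrightarrow> 0 \<in> G \<and> (\<forall>x\<in>G. \<forall>y\<in>G. x - y \<in> G)"

lemma add_subgroupD:
  fixes G :: "'a::real_vector set"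
  assumes "add_subgroup G"
  shows "0 \<in> G" "x \<in> G \<Longrightarrow> - x \<in> G" "x \<in> G \<Longrightarrow> y \<in> G \<Longrightarrow> x + y \<in> G"
    "x \<in> G \<Longrightarrow> y \<in> G \<Longrightarrow> x - y \<in> G"
    "(\<And>i. i \<in> I \<Longrightarrow> f i \<in> G) \<Longrightarrow> sum f I \<in> G"
    "x \<in> G \<Longrightarrow> real k *\<^sub>R x \<in> G"
proof -
  show 0: "0 \<in> G" and diff: "x \<in> G \<Longrightarrow> y \<in> G \<Longrightarrow> x - y \<in> G" for x y
    using assms by (auto simp: add_subgroup_def)
  show neg: "- x \<in> G" if "x \<in> G" for x
    using diff[OF 0 that] by simp
  show add: "x + y \<in> G" if "x \<in> G" "y \<in> G" for x y
    using diff[OF that(1) neg[OF that(2)]] by simp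
  show "sum f I \<in> G" if "\<And>i. i \<in> I \<Longrightarrow> f i \<in> G"
    using that by (induction I rule: infinite_finite_induct) (auto intro: 0 add)
  show "real k *\<^sub>R x \<in> G" if "x \<in> G"
    by (induction k) (auto simp: scaleR_left_distrib intro: 0 add that)
qed

text \<open>A sum and all but one of its terms determine the missing term.\<close>

lemma add_subgroup_missing:
  fixes f :: "nat \<Rightarrow> 'a::real_vector"
  assumes G: "add_subgroup G" and s: "(\<Sum>i<N. f i) \<in> G"
    and "k < N" "\<And>i. i < N \<Longrightarrow> i \<noteq> k \<Longrightarrow> f i \<in> G" "i < N"
  shows "f i \<in> G"
proof (cases "i = k")
  case True
  have "f k = (\<Sum>i<N. f i) - (\<Sum>i\<in>{..<N} - {k}. f i)"
    using assms(3) by (simp add: sum.remove)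
  moreover have "(\<Sum>i\<in>{..<N} - {k}. f i) \<in> G"
    using assms(4) by (intro add_subgroupD(5)[OF G]) auto
  ultimately show ?thesis using add_subgroupD(4)[OF G s] True by simp
qed (use assms in auto)

text \<open>
  The vertices are handled through labels, so that the same combinatorics applies to the vectors
  and to the values of functionals at them: \<open>VL i\<close> stands for \<open>v_i\<close>, and similarly for the other
  classes; \<open>SL j i\<close> is the \<open>i\<close>-th vertex of block \<open>j\<close>.
\<close>

datatype lab = VL nat | YL nat | UL nat | ZL | TL | SL nat nat

locale fano_params =
  fixes K p m :: nat and \<alpha> \<beta> :: "nat \<Rightarrow> nat"
  assumes K: "2 \<le> K" and p: "1 \<le> p" and \<alpha>\<beta>: "\<And>j. j < m \<Longrightarrow> 1 \<le> \<alpha> j + \<beta> j"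
begin

definition \<kappa> :: nat where "\<kappa> = K + p - 1"

definition q :: "nat \<Rightarrow> nat" where "q j = p * (\<alpha> j + \<beta> j) + 1"

text \<open>
  The number of labels minus the number \<open>3 + m\<close> of independent relations.
\<close>

definition dimension :: nat where "dimension = K + 2 * p - 1 + (\<Sum>j<m. p * (\<alpha> j + \<beta> j))"

definition L :: "lab set" where
  "L = {l. case l of VL i \<Rightarrow> i < K | YL i \<Rightarrow> i < p | UL i \<Rightarrow> i < p | ZL \<Rightarrow> True | TL \<Rightarrow> True
         | SL j i \<Rightarrow> j < m \<and> i < q j}"

lemma L_simps [simp]:
  "VL i \<in> L \<longleftrightarrow> i < K" "YL i \<in> L \<longleftrightarrow> i < p" "UL i \<in> L \<longleftrightarrow> i < p" "ZL \<in> L" "TL \<in> L"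
  "SL j i \<in> L \<longleftrightarrow> j < m \<and> i < q j"
  by (auto simp: L_def)

lemma L_eq:
  "L = VL ` {..<K} \<union> (YL ` {..<p} \<union> (UL ` {..<p} \<union> ({ZL, TL} \<union> (\<lambda>(j, i). SL j i) ` (SIGMA j:{..<m}. {..<q j}))))"
proof (rule set_eqI)
  fix l show "l \<in> L \<longleftrightarrow> l \<in> VL ` {..<K} \<union> (YL ` {..<p} \<union> (UL ` {..<p} \<union> ({ZL, TL} \<union> (\<lambda>(j, i). SL j i) ` (SIGMA j:{..<m}. {..<q j}))))"
    by (cases l) auto
qed

lemma finite_L: "finite L"
  by (simp add: L_eq)

definition sumV :: "(lab \<Rightarrow> 'a::comm_monoid_add) \<Rightarrow> 'a" where "sumV \<phi> = (\<Sum>i<K. \<phi> (VL i))"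
definition sumY :: "(lab \<Rightarrow> 'a::comm_monoid_add) \<Rightarrow> 'a" where "sumY \<phi> = (\<Sum>i<p. \<phi> (YL i))"
definition sumU :: "(lab \<Rightarrow> 'a::comm_monoid_add) \<Rightarrow> 'a" where "sumU \<phi> = (\<Sum>i<p. \<phi> (UL i))"
definition sumS :: "nat \<Rightarrow> (lab \<Rightarrow> 'a::comm_monoid_add) \<Rightarrow> 'a" where "sumS j \<phi> = (\<Sum>i<q j. \<phi> (SL j i))"

lemma sum_L: "(\<Sum>l\<in>L. f l) = sumV f + sumY f + sumU f + f ZL + f TL + (\<Sum>j<m. sumS j f)"
  for f :: "lab \<Rightarrow> 'a::comm_monoid_add"
proof -
  have u: "sum f (A \<union> B) = sum f A + sum f B" if "finite A" "finite B" "A \<inter> B = {}" for A B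
    using that by (rule sum.union_disjoint)
  have "(\<Sum>l\<in>L. f l) = sum f (VL ` {..<K}) + (sum f (YL ` {..<p}) + (sum f (UL ` {..<p}) +
     (sum f {ZL, TL} + sum f ((\<lambda>(j, i). SL j i) ` (SIGMA j:{..<m}. {..<q j})))))"
    unfolding L_eq by (subst u, simp, simp, force)+ simp
  also have "sum f (VL ` {..<K}) = sumV f"
    unfolding sumV_def by (subst sum.reindex) (auto simp: inj_on_def)
  also have "sum f (YL ` {..<p}) = sumY f"
    unfolding sumY_def by (subst sum.reindex) (auto simp: inj_on_def)
  also have "sum f (UL ` {..<p}) = sumU f"
    unfolding sumU_def by (subst sum.reindex) (auto simp: inj_on_def)
  also have "sum f ((\<lambda>(j, i). SL j i) ` (SIGMA j:{..<m}. {..<q j})) = (\<Sum>j<m. sumS j f)"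
    unfolding sumS_def
    by (subst sum.reindex) (auto simp: inj_on_def sum.Sigma case_prod_unfold)
  finally show ?thesis by (simp add: add.assoc)
qed

lemma card_L: "card L = dimension + 3 + m"
proof -
  have "card L = (\<Sum>l\<in>L. 1)" by simp
  also have "\<dots> = K + p + p + 1 + 1 + (\<Sum>j<m. q j)"
    unfolding sum_L by (simp add: sumV_def sumY_def sumU_def sumS_def)
  also have "(\<Sum>j<m. q j) = (\<Sum>j<m. p * (\<alpha> j + \<beta> j)) + m"
    by (simp add: q_def sum.distrib sum_Suc)
  finally show ?thesis using p by (simp add: dimension_def)
qed

text \<open>
  A family indexed by the labels is admissible if it satisfies the relations. The vertices
  themselves form an admissible family, and a real-valued family is admissible if and only if it
  consists of the values of a linear functional at the vertices.
\<close>

definition adm :: "(lab \<Rightarrow> 'a::real_vector) \<Rightarrow> bool" where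
  "adm \<phi> \<longleftrightarrow> \<phi> ZL = - \<phi> TL \<and> sumV \<phi> + sumY \<phi> = real \<kappa> *\<^sub>R \<phi> TL \<and> sumU \<phi> = sumY \<phi> + \<phi> ZL \<and>
     (\<forall>j<m. sumS j \<phi> = real (\<alpha> j) *\<^sub>R sumY \<phi> + real (\<beta> j) *\<^sub>R sumU \<phi>)"

text \<open>Indices of one vertex in each class; these are the candidates for being missed by a facet.\<close>

definition choice :: "nat \<Rightarrow> nat \<Rightarrow> nat \<Rightarrow> (nat \<Rightarrow> nat) \<Rightarrow> bool" where
  "choice v0 y0 u0 \<sigma> \<longleftrightarrow> v0 < K \<and> y0 < p \<and> u0 < p \<and> (\<forall>j<m. \<sigma> j < q j)"

text \<open>
  The relations recover an admissible family from its value at \<open>TL\<close>, its sum over the \<open>YL\<close>, and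
  all but one of its values in each class, using additions and subtractions only.
\<close>

lemma adm_subgroup:
  fixes f :: "lab \<Rightarrow> 'a::real_vector"
  assumes G: "add_subgroup G" and adm: "adm f" and t: "f TL \<in> G" and y: "sumY f \<in> G"
    and c: "choice v0 y0 u0 \<sigma>"
    and mem: "\<And>i. i < K \<Longrightarrow> i \<noteq> v0 \<Longrightarrow> f (VL i) \<in> G"
      "\<And>i. i < p \<Longrightarrow> i \<noteq> y0 \<Longrightarrow> f (YL i) \<in> G"
      "\<And>i. i < p \<Longrightarrow> i \<noteq> u0 \<Longrightarrow> f (UL i) \<in> G"
      "\<And>j i. j < m \<Longrightarrow> i < q j \<Longrightarrow> i \<noteq> \<sigma> j \<Longrightarrow> f (SL j i) \<in> G"
    and l: "l \<in> L"
  shows "f l \<in> G"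
proof -
  note G' = add_subgroupD[OF G]
  have z: "f ZL \<in> G" using adm G'(2)[OF t] by (simp add: adm_def)
  have "sumV f = real \<kappa> *\<^sub>R f TL - sumY f" using adm by (simp add: adm_def eq_diff_eq)
  then have v: "sumV f \<in> G" using G'(4)[OF G'(6)[OF t] y] by simp
  have u: "sumU f \<in> G" using adm G'(3)[OF y z] by (simp add: adm_def)
  have s: "sumS j f \<in> G" if "j < m" for j
    using adm G'(3)[OF G'(6)[OF y] G'(6)[OF u]] that by (simp add: adm_def)
  show ?thesis
  proof (cases l)
    case (VL i)
    then show ?thesis
      using add_subgroup_missing[OF G v[unfolded sumV_def], of v0] mem(1) c l by (auto simp: choice_def)
  next
    case (YL i)
    then show ?thesis
      using add_subgroup_missing[OF G y[unfolded sumY_def], of y0] mem(2) c l by (auto simp: choice_def)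
  next
    case (UL i)
    then show ?thesis
      using add_subgroup_missing[OF G u[unfolded sumU_def], of u0] mem(3) c l by (auto simp: choice_def)
  next
    case (SL j i)
    then have ji: "j < m" "i < q j" using l by auto
    have "f (SL j i) \<in> G"
      by (rule add_subgroup_missing[OF G s[OF ji(1), unfolded sumS_def], of "\<sigma> j"])
        (use c mem(4)[OF ji(1)] ji in \<open>auto simp: choice_def\<close>)
    then show ?thesis using SL by simp
  qed (use t z in auto)
qed

lemma adm_eqI:
  fixes \<phi> \<psi> :: "lab \<Rightarrow> 'a::real_vector"
  assumes adm: "adm \<phi>" "adm \<psi>" and t: "\<phi> TL = \<psi> TL" and y: "sumY \<phi> = sumY \<psi>"
    and c: "choice v0 y0 u0 \<sigma>"
    and eq: "\<And>i. i < K \<Longrightarrow> i \<noteq> v0 \<Longrightarrow> \<phi> (VL i) = \<psi> (VL i)"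
      "\<And>i. i < p \<Longrightarrow> i \<noteq> y0 \<Longrightarrow> \<phi> (YL i) = \<psi> (YL i)"
      "\<And>i. i < p \<Longrightarrow> i \<noteq> u0 \<Longrightarrow> \<phi> (UL i) = \<psi> (UL i)"
      "\<And>j i. j < m \<Longrightarrow> i < q j \<Longrightarrow> i \<noteq> \<sigma> j \<Longrightarrow> \<phi> (SL j i) = \<psi> (SL j i)"
    and l: "l \<in> L"
  shows "\<phi> l = \<psi> l"
proof -
  have S: "sumV (\<lambda>l. \<phi> l - \<psi> l) = sumV \<phi> - sumV \<psi>" "sumY (\<lambda>l. \<phi> l - \<psi> l) = sumY \<phi> - sumY \<psi>"
    "sumU (\<lambda>l. \<phi> l - \<psi> l) = sumU \<phi> - sumU \<psi>" "sumS j (\<lambda>l. \<phi> l - \<psi> l) = sumS j \<phi> - sumS j \<psi>" for j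
    by (simp_all add: sumV_def sumY_def sumU_def sumS_def sum_subtractf)
  have ad: "adm (\<lambda>l. \<phi> l - \<psi> l)"
    using adm unfolding adm_def S by (simp add: algebra_simps)
  have G: "add_subgroup {0 :: 'a}" by (simp add: add_subgroup_def)
  have "\<phi> l - \<psi> l \<in> {0}"
    by (rule adm_subgroup[where f = "\<lambda>l. \<phi> l - \<psi> l", OF G ad _ _ c _ _ _ _ l])
      (use t y eq S in auto)
  then show ?thesis by simp
qed

text \<open>
  The admissible family with value \<open>\<tau>\<close> at \<open>TL\<close> and sum \<open>\<eta>\<close> over the \<open>YL\<close> that equals one
  everywhere except possibly at the chosen vertices, whose values are dictated by the relations.
\<close>

fun phi :: "real \<Rightarrow> real \<Rightarrow> nat \<Rightarrow> nat \<Rightarrow> nat \<Rightarrow> (nat \<Rightarrow> nat) \<Rightarrow> lab \<Rightarrow> real" where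
  "phi \<tau> \<eta> v0 y0 u0 \<sigma> TL = \<tau>"
| "phi \<tau> \<eta> v0 y0 u0 \<sigma> ZL = - \<tau>"
| "phi \<tau> \<eta> v0 y0 u0 \<sigma> (VL i) = (if i = v0 then real \<kappa> * \<tau> - \<eta> - (real K - 1) else 1)"
| "phi \<tau> \<eta> v0 y0 u0 \<sigma> (YL i) = (if i = y0 then \<eta> - (real p - 1) else 1)"
| "phi \<tau> \<eta> v0 y0 u0 \<sigma> (UL i) = (if i = u0 then \<eta> - \<tau> - (real p - 1) else 1)"
| "phi \<tau> \<eta> v0 y0 u0 \<sigma> (SL j i) =
     (if i = \<sigma> j then real (\<alpha> j) * (\<eta> - real p) + real (\<beta> j) * (\<eta> - \<tau> - real p) else 1)"

lemma sum_if_one: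
  assumes "k < N"
  shows "(\<Sum>i<N. if i = k then c else (1::real)) = c + (real N - 1)"
proof -
  have "(\<Sum>i<N. if i = k then c else (1::real)) = (\<Sum>i<N. 1 + (if i = k then c - 1 else 0))"
    by (intro sum.cong) auto
  also have "\<dots> = real N + (c - 1)"
    using assms by (simp add: sum.distrib)
  finally show ?thesis by simp
qed

lemma phi_sums:
  assumes "choice v0 y0 u0 \<sigma>"
  shows "sumV (phi \<tau> \<eta> v0 y0 u0 \<sigma>) = real \<kappa> * \<tau> - \<eta>"
    "sumY (phi \<tau> \<eta> v0 y0 u0 \<sigma>) = \<eta>" "sumU (phi \<tau> \<eta> v0 y0 u0 \<sigma>) = \<eta> - \<tau>"
    "j < m \<Longrightarrow> sumS j (phi \<tau> \<eta> v0 y0 u0 \<sigma>) = real (\<alpha> j) * \<eta> + real (\<beta> j) * (\<eta> - \<tau>)"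
proof -
  show "sumV (phi \<tau> \<eta> v0 y0 u0 \<sigma>) = real \<kappa> * \<tau> - \<eta>"
    "sumY (phi \<tau> \<eta> v0 y0 u0 \<sigma>) = \<eta>" "sumU (phi \<tau> \<eta> v0 y0 u0 \<sigma>) = \<eta> - \<tau>"
    using assms by (simp_all add: sumV_def sumY_def sumU_def choice_def sum_if_one)
  assume "j < m"
  then have "\<sigma> j < q j" using assms by (simp add: choice_def)
  then have "sumS j (phi \<tau> \<eta> v0 y0 u0 \<sigma>) =
    real (\<alpha> j) * (\<eta> - real p) + real (\<beta> j) * (\<eta> - \<tau> - real p) + (real (q j) - 1)"
    by (simp add: sumS_def sum_if_one)
  also have "real (q j) - 1 = real p * real (\<alpha> j) + real p * real (\<beta> j)"
    by (simp add: q_def distrib_left)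
  finally show "sumS j (phi \<tau> \<eta> v0 y0 u0 \<sigma>) = real (\<alpha> j) * \<eta> + real (\<beta> j) * (\<eta> - \<tau>)"
    by (simp add: algebra_simps)
qed

lemma phi_adm: "choice v0 y0 u0 \<sigma> \<Longrightarrow> adm (phi \<tau> \<eta> v0 y0 u0 \<sigma>)"
  by (auto simp: adm_def phi_sums)

text \<open>
  For five values of \<open>(\<tau>, \<eta>)\<close>, exactly two of the values at \<open>z\<close>, \<open>t\<close> and the chosen \<open>v, y, u\<close>
  are one. In the order below, the level set of one misses
  \<open>v, u, z\<close>, then \<open>v, z, t\<close>, then \<open>v, y, t\<close>, then \<open>y, u, z\<close>, and finally \<open>y, u, t\<close>; these are the
  minimal vertex covers of the pentagon \<open>V, Y, z, t, U\<close>.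
\<close>

definition facet_type :: "real \<Rightarrow> real \<Rightarrow> bool" where
  "facet_type \<tau> \<eta> \<longleftrightarrow> (\<tau>, \<eta>) \<in> {(1, real p), (0, real p), (-1, real p - 1), (1, real p - 1),
     (-1, - real \<kappa> - real K)}"

lemma \<kappa>_real: "real \<kappa> = real K + real p - 1"
  using p by (simp add: \<kappa>_def)

lemma facet_type_bounds:
  assumes "facet_type \<tau> \<eta>"
  shows "\<tau> \<le> 1" "- \<tau> \<le> 1" "\<eta> \<le> real p" "\<eta> - \<tau> \<le> real p" "real \<kappa> * \<tau> - \<eta> \<le> real K"
  using assms K p by (auto simp: facet_type_def \<kappa>_real)

lemma phi_le_one:
  assumes "facet_type \<tau> \<eta>"
  shows "phi \<tau> \<eta> v0 y0 u0 \<sigma> l \<le> 1"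
proof -
  note b = facet_type_bounds[OF assms]
  have "real (\<alpha> j) * (\<eta> - real p) + real (\<beta> j) * (\<eta> - \<tau> - real p) \<le> 0" for j
    using b by (intro add_nonpos_nonpos mult_nonneg_nonpos) auto
  then have "real (\<alpha> j) * (\<eta> - real p) + real (\<beta> j) * (\<eta> - \<tau> - real p) \<le> 1" for j
    using order_trans zero_le_one by blast
  then show ?thesis
    using b by (cases l) auto
qed

lemma phi_SL_le_zero:
  assumes "facet_type \<tau> \<eta>"
  shows "phi \<tau> \<eta> v0 y0 u0 \<sigma> (SL j (\<sigma> j)) \<le> 0"
  using facet_type_bounds[OF assms]
  by (auto intro!: add_nonpos_nonpos mult_nonneg_nonpos)

definition omitted :: "lab \<Rightarrow> lab \<Rightarrow> lab \<Rightarrow> (nat \<Rightarrow> nat) \<Rightarrow> lab set" where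
  "omitted a b c \<sigma> = {a, b, c} \<union> (\<lambda>j. SL j (\<sigma> j)) ` {..<m}"

lemma card_L_omitted:
  assumes "{a, b, c} \<subseteq> L" "a \<noteq> b" "a \<noteq> c" "b \<noteq> c" "{a, b, c} \<inter> range (case_prod SL) = {}"
    and "\<forall>j<m. \<sigma> j < q j"
  shows "card (L - omitted a b c \<sigma>) = dimension"
proof -
  have "inj_on (\<lambda>j. SL j (\<sigma> j)) {..<m}" by (auto simp: inj_on_def)
  then have "card ((\<lambda>j. SL j (\<sigma> j)) ` {..<m}) = m" by (simp add: card_image)
  moreover have "{a, b, c} \<inter> (\<lambda>j. SL j (\<sigma> j)) ` {..<m} = {}"
    using assms(5) by force
  moreover have "card {a, b, c} = 3" using assms by auto
  ultimately have "card (omitted a b c \<sigma>) = 3 + m"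
    unfolding omitted_def by (subst card_Un_disjoint) auto
  moreover have "omitted a b c \<sigma> \<subseteq> L"
    using assms by (auto simp: omitted_def)
  ultimately show ?thesis
    using card_L finite_L finite_subset by (subst card_Diff_subset) auto
qed

lemma phi_tight:
  assumes "choice v0 y0 u0 \<sigma>"
  shows "{l \<in> L. phi 1 (real p) v0 y0 u0 \<sigma> l = 1} = L - omitted (VL v0) (UL u0) ZL \<sigma>"
    "{l \<in> L. phi 0 (real p) v0 y0 u0 \<sigma> l = 1} = L - omitted (VL v0) ZL TL \<sigma>"
    "{l \<in> L. phi (-1) (real p - 1) v0 y0 u0 \<sigma> l = 1} = L - omitted (VL v0) (YL y0) TL \<sigma>"
    "{l \<in> L. phi 1 (real p - 1) v0 y0 u0 \<sigma> l = 1} = L - omitted (YL y0) (UL u0) ZL \<sigma>"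
    "{l \<in> L. phi (-1) (- real \<kappa> - real K) v0 y0 u0 \<sigma> l = 1} = L - omitted (YL y0) (UL u0) TL \<sigma>"
proof -
  have S: "phi \<tau> \<eta> v0 y0 u0 \<sigma> (SL j i) = 1 \<longleftrightarrow> i \<noteq> \<sigma> j" if "facet_type \<tau> \<eta>" for \<tau> \<eta> j i
    using phi_SL_le_zero[OF that, of v0 y0 u0 \<sigma> j] by (cases "i = \<sigma> j") auto
  have main: "{l \<in> L. phi \<tau> \<eta> v0 y0 u0 \<sigma> l = 1} = L - omitted a b c \<sigma>"
    if "facet_type \<tau> \<eta>" "{a, b, c} \<inter> range (case_prod SL) = {}"
      and "\<And>l. l \<notin> range (case_prod SL) \<Longrightarrow> phi \<tau> \<eta> v0 y0 u0 \<sigma> l = 1 \<longleftrightarrow> l \<notin> {a, b, c}" for \<tau> \<eta> a b c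
  proof (rule set_eqI)
    fix l
    show "l \<in> {l \<in> L. phi \<tau> \<eta> v0 y0 u0 \<sigma> l = 1} \<longleftrightarrow> l \<in> L - omitted a b c \<sigma>"
    proof (cases "\<exists>j i. l = SL j i")
      case True
      then obtain j i where l: "l = SL j i" by blast
      then have "l \<notin> {a, b, c}" using that(2) by force
      then show ?thesis
        using S[OF that(1), of j i] by (auto simp: l omitted_def)
    next
      case False
      then have "l \<notin> range (case_prod SL)" by auto
      then show ?thesis
        using that(3)[of l] False by (auto simp: omitted_def)
    qed
  qed
  have NS: "l \<notin> range (case_prod SL) \<Longrightarrow> (\<And>i. l = VL i \<Longrightarrow> Q) \<Longrightarrow> (\<And>i. l = YL i \<Longrightarrow> Q) \<Longrightarrow>
    (\<And>i. l = UL i \<Longrightarrow> Q) \<Longrightarrow> (l = ZL \<Longrightarrow> Q) \<Longrightarrow> (l = TL \<Longrightarrow> Q) \<Longrightarrow> Q" for l Q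
    by (cases l) auto
  have pos: "real K \<ge> 2" "real p \<ge> 1" using K p by auto
  show "{l \<in> L. phi 1 (real p) v0 y0 u0 \<sigma> l = 1} = L - omitted (VL v0) (UL u0) ZL \<sigma>"
    by (rule main, simp add: facet_type_def, force, erule NS) (use pos in \<open>auto simp: \<kappa>_real\<close>)
  show "{l \<in> L. phi 0 (real p) v0 y0 u0 \<sigma> l = 1} = L - omitted (VL v0) ZL TL \<sigma>"
    by (rule main, simp add: facet_type_def, force, erule NS) (use pos in \<open>auto simp: \<kappa>_real\<close>)
  show "{l \<in> L. phi (-1) (real p - 1) v0 y0 u0 \<sigma> l = 1} = L - omitted (VL v0) (YL y0) TL \<sigma>"
    by (rule main, simp add: facet_type_def, force, erule NS) (use pos in \<open>auto simp: \<kappa>_real\<close>)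
  show "{l \<in> L. phi 1 (real p - 1) v0 y0 u0 \<sigma> l = 1} = L - omitted (YL y0) (UL u0) ZL \<sigma>"
    by (rule main, simp add: facet_type_def, force, erule NS) (use pos in \<open>auto simp: \<kappa>_real\<close>)
  show "{l \<in> L. phi (-1) (- real \<kappa> - real K) v0 y0 u0 \<sigma> l = 1} = L - omitted (YL y0) (UL u0) TL \<sigma>"
    by (rule main, simp add: facet_type_def, force, erule NS) (use pos in \<open>auto simp: \<kappa>_real\<close>)
qed

lemma card_phi_tight:
  assumes "facet_type \<tau> \<eta>" "choice v0 y0 u0 \<sigma>"
  shows "card {l \<in> L. phi \<tau> \<eta> v0 y0 u0 \<sigma> l = 1} = dimension"
  using assms(1) unfolding facet_type_def
  by (auto simp: phi_tight[OF assms(2)] intro!: card_L_omitted)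
     (use assms(2) in \<open>auto simp: choice_def\<close>)

end

section \<open>The smooth Fano polytopes\<close>

context fano_params
begin

lemma sums_le:
  fixes \<phi> :: "lab \<Rightarrow> real"
  assumes "\<And>l. l \<in> L \<Longrightarrow> \<phi> l \<le> 1"
  shows "sumV \<phi> \<le> real K" "sumY \<phi> \<le> real p" "sumU \<phi> \<le> real p"
  using sum_bounded_above[of "{..<K}" "\<lambda>i. \<phi> (VL i)" 1] sum_bounded_above[of "{..<p}" "\<lambda>i. \<phi> (YL i)" 1]
    sum_bounded_above[of "{..<p}" "\<lambda>i. \<phi> (UL i)" 1] assms
  by (auto simp: sumV_def sumY_def sumU_def)

text \<open>
  Arrange the classes \<open>V, Y, {z}, {t}, U\<close> in a pentagon. Two cyclically consecutive classes cannot
  both lie in the level set of one, because the sum of their elements is a combination of vertices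
  with smaller total weight; the same holds for a whole block. So the level set misses a vertex cover
  of the pentagon and a vertex of every block. The hypothesis on the cardinality says that it misses
  nothing else, and then the relations determine the remaining values.
\<close>

lemma adm_facet_classification:
  fixes \<phi> :: "lab \<Rightarrow> real"
  assumes adm: "adm \<phi>" and le: "\<And>l. l \<in> L \<Longrightarrow> \<phi> l \<le> 1"
    and card: "dimension \<le> card {l \<in> L. \<phi> l = 1}"
  shows "\<exists>\<tau> \<eta> v0 y0 u0 \<sigma>. facet_type \<tau> \<eta> \<and> choice v0 y0 u0 \<sigma> \<and>
    (\<forall>l\<in>L. \<phi> l = phi \<tau> \<eta> v0 y0 u0 \<sigma> l)"
proof -
  note b = sums_le[of \<phi>, OF le]
  have t: "\<phi> TL \<le> 1" and z: "\<phi> ZL = - \<phi> TL" "\<phi> ZL \<le> 1"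
    using le[of ZL] le[of TL] adm by (auto simp: adm_def)
  have rV: "sumV \<phi> + sumY \<phi> = real \<kappa> * \<phi> TL" and rU: "sumU \<phi> = sumY \<phi> + \<phi> ZL"
    using adm by (auto simp: adm_def)
  have fV: "sumV \<phi> = real K" if "\<And>i. i < K \<Longrightarrow> \<phi> (VL i) = 1" using that by (simp add: sumV_def)
  have fY: "sumY \<phi> = real p" if "\<And>i. i < p \<Longrightarrow> \<phi> (YL i) = 1" using that by (simp add: sumY_def)
  have fU: "sumU \<phi> = real p" if "\<And>i. i < p \<Longrightarrow> \<phi> (UL i) = 1" using that by (simp add: sumU_def)
  have pos: "real K \<ge> 2" "real p \<ge> 1" using K p by auto
  have kt: "real \<kappa> * \<phi> TL \<le> real \<kappa>" "(real \<kappa> - 1) * \<phi> TL \<le> real \<kappa> - 1"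
    using t pos by (auto simp: \<kappa>_real mult_le_cancel_left2)
  have "\<exists>i<q j. \<phi> (SL j i) \<noteq> 1" if "j < m" for j
  proof (rule ccontr)
    assume "\<not> (\<exists>i<q j. \<phi> (SL j i) \<noteq> 1)"
    then have "sumS j \<phi> = real (q j)" by (simp add: sumS_def)
    moreover have "sumS j \<phi> = real (\<alpha> j) * sumY \<phi> + real (\<beta> j) * sumU \<phi>"
      using adm that by (simp add: adm_def)
    moreover have "real (\<alpha> j) * sumY \<phi> \<le> real (\<alpha> j) * real p" "real (\<beta> j) * sumU \<phi> \<le> real (\<beta> j) * real p"
      using b by (auto intro: mult_left_mono)
    ultimately show False by (simp add: q_def algebra_simps)
  qed
  then obtain \<sigma> where \<sigma>: "\<And>j. j < m \<Longrightarrow> \<sigma> j < q j" "\<And>j. j < m \<Longrightarrow> \<phi> (SL j (\<sigma> j)) \<noteq> 1"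
    by metis
  have tight: "{l \<in> L. \<phi> l = 1} = L - omitted a b c \<sigma>"
    if "{a, b, c} \<subseteq> L" "a \<noteq> b" "a \<noteq> c" "b \<noteq> c" "{a, b, c} \<inter> range (case_prod SL) = {}"
      "\<phi> a \<noteq> 1" "\<phi> b \<noteq> 1" "\<phi> c \<noteq> 1" for a b c
  proof (rule card_subset_eq)
    show sub: "{l \<in> L. \<phi> l = 1} \<subseteq> L - omitted a b c \<sigma>"
      using that \<sigma>(2) by (auto simp: omitted_def)
    have "card (L - omitted a b c \<sigma>) = dimension"
      using \<sigma>(1) by (intro card_L_omitted that) auto
    moreover have "card {l \<in> L. \<phi> l = 1} \<le> card (L - omitted a b c \<sigma>)"
      using finite_L by (intro card_mono sub) auto
    ultimately show "card {l \<in> L. \<phi> l = 1} = card (L - omitted a b c \<sigma>)"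
      using card by simp
  qed (simp add: finite_L)
  have choice: "choice v0 y0 u0 \<sigma>" if "v0 < K" "y0 < p" "u0 < p" for v0 y0 u0
    using that \<sigma> by (simp add: choice_def)
  have fin: ?thesis if "facet_type \<tau> \<eta>" "v0 < K" "y0 < p" "u0 < p"
      "{l \<in> L. \<phi> l = 1} = L - omitted a b c \<sigma>" "{a, b, c} \<inter> range (case_prod SL) = {}"
      "\<And>i. VL i \<in> {a, b, c} \<Longrightarrow> i = v0" "\<And>i. YL i \<in> {a, b, c} \<Longrightarrow> i = y0" "\<And>i. UL i \<in> {a, b, c} \<Longrightarrow> i = u0"
      "\<phi> TL = \<tau>" "sumY \<phi> = \<eta>" for \<tau> \<eta> v0 y0 u0 a b c
  proof (intro exI conjI ballI)
    show "facet_type \<tau> \<eta>" using that(1) .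
    show ch: "choice v0 y0 u0 \<sigma>" using choice[OF that(2-4)] .
    have mem: "\<phi> l = 1" if "l \<in> L" "l \<notin> omitted a b c \<sigma>" for l
      using that \<open>{l \<in> L. \<phi> l = 1} = L - omitted a b c \<sigma>\<close> by blast
    have noSL: "SL j i \<notin> {a, b, c}" for j i using that(6) by force
    fix l assume l: "l \<in> L"
    show "\<phi> l = phi \<tau> \<eta> v0 y0 u0 \<sigma> l"
    proof (rule adm_eqI[OF adm phi_adm[OF ch] _ _ ch _ _ _ _ l])
      show "\<phi> TL = phi \<tau> \<eta> v0 y0 u0 \<sigma> TL" "sumY \<phi> = sumY (phi \<tau> \<eta> v0 y0 u0 \<sigma>)"
        using that(10,11) by (simp_all add: phi_sums[OF ch])
      show "\<phi> (VL i) = phi \<tau> \<eta> v0 y0 u0 \<sigma> (VL i)" if "i < K" "i \<noteq> v0" for i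
        using mem[of "VL i"] that \<open>\<And>i. VL i \<in> {a, b, c} \<Longrightarrow> i = v0\<close>[of i] by (auto simp: omitted_def)
      show "\<phi> (YL i) = phi \<tau> \<eta> v0 y0 u0 \<sigma> (YL i)" if "i < p" "i \<noteq> y0" for i
        using mem[of "YL i"] that \<open>\<And>i. YL i \<in> {a, b, c} \<Longrightarrow> i = y0\<close>[of i] by (auto simp: omitted_def)
      show "\<phi> (UL i) = phi \<tau> \<eta> v0 y0 u0 \<sigma> (UL i)" if "i < p" "i \<noteq> u0" for i
        using mem[of "UL i"] that \<open>\<And>i. UL i \<in> {a, b, c} \<Longrightarrow> i = u0\<close>[of i] by (auto simp: omitted_def)
      show "\<phi> (SL j i) = phi \<tau> \<eta> v0 y0 u0 \<sigma> (SL j i)" if "j < m" "i < q j" "i \<noteq> \<sigma> j" for j i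
        using mem[of "SL j i"] that noSL[of j i] by (auto simp: omitted_def)
    qed
  qed
  let ?V = "\<forall>i<K. \<phi> (VL i) = 1" and ?Y = "\<forall>i<p. \<phi> (YL i) = 1" and ?U = "\<forall>i<p. \<phi> (UL i) = 1"
  have "\<not> (\<phi> ZL = 1 \<and> \<phi> TL = 1)" using z by auto
  moreover have "\<not> (?Y \<and> \<phi> ZL = 1)" using fY rU b by auto
  moreover have "\<not> (?U \<and> \<phi> TL = 1)" using fU rU b z by auto
  moreover have "\<not> (?V \<and> ?Y)"
  proof
    assume "?V \<and> ?Y"
    then have "sumV \<phi> = real K" "sumY \<phi> = real p" using fV fY by blast+
    then show False using rV kt(1) \<kappa>_real by linarith
  qed
  moreover have "\<not> (?V \<and> ?U)"
  proof
    assume "?V \<and> ?U"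
    then have "sumV \<phi> = real K" "sumU \<phi> = real p" using fV fU by blast+
    moreover have "real \<kappa> * \<phi> TL = (real \<kappa> - 1) * \<phi> TL + \<phi> TL" by (simp add: algebra_simps)
    ultimately show False using rV rU z(1) kt(2) \<kappa>_real by linarith
  qed
  ultimately consider
    (1) "\<not> ?V" "\<not> ?U" "\<phi> ZL \<noteq> 1" | (2) "\<not> ?V" "\<phi> ZL \<noteq> 1" "\<phi> TL \<noteq> 1"
    | (3) "\<not> ?V" "\<not> ?Y" "\<phi> TL \<noteq> 1" | (4) "\<not> ?Y" "\<not> ?U" "\<phi> ZL \<noteq> 1" | (5) "\<not> ?Y" "\<not> ?U" "\<phi> TL \<noteq> 1"
    by blast
  then show ?thesis
  proof cases
    case 1
    then obtain v0 u0 where i: "v0 < K" "u0 < p" "\<phi> (VL v0) \<noteq> 1" "\<phi> (UL u0) \<noteq> 1" by blast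
    have T: "{l \<in> L. \<phi> l = 1} = L - omitted (VL v0) (UL u0) ZL \<sigma>"
      by (rule tight) (use i 1 in auto)
    have one: "\<phi> l = 1" if "l \<in> L - omitted (VL v0) (UL u0) ZL \<sigma>" for l using T that by blast
    have w: "\<phi> TL = 1" by (rule one) (auto simp: omitted_def)
    have s: "sumY \<phi> = real p" by (rule fY, rule one) (auto simp: omitted_def)
    from w s show ?thesis
      by (intro fin[of 1 "real p" v0 0 u0, OF _ _ _ _ T]) (use i p in \<open>auto simp: facet_type_def\<close>)
  next
    case 2
    then obtain v0 where i: "v0 < K" "\<phi> (VL v0) \<noteq> 1" by blast
    have T: "{l \<in> L. \<phi> l = 1} = L - omitted (VL v0) ZL TL \<sigma>"
      by (rule tight) (use i 2 in auto)
    have one: "\<phi> l = 1" if "l \<in> L - omitted (VL v0) ZL TL \<sigma>" for l using T that by blast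
    have w: "sumY \<phi> = real p" by (rule fY, rule one) (auto simp: omitted_def)
    have s: "sumU \<phi> = real p" by (rule fU, rule one) (auto simp: omitted_def)
    from w s have "\<phi> TL = 0" "sumY \<phi> = real p" using rU z by auto
    then show ?thesis
      by (intro fin[of 0 "real p" v0 0 0, OF _ _ _ _ T]) (use i p in \<open>auto simp: facet_type_def\<close>)
  next
    case 3
    then obtain v0 y0 where i: "v0 < K" "y0 < p" "\<phi> (VL v0) \<noteq> 1" "\<phi> (YL y0) \<noteq> 1" by blast
    have T: "{l \<in> L. \<phi> l = 1} = L - omitted (VL v0) (YL y0) TL \<sigma>"
      by (rule tight) (use i 3 in auto)
    have one: "\<phi> l = 1" if "l \<in> L - omitted (VL v0) (YL y0) TL \<sigma>" for l using T that by blast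
    have w: "\<phi> ZL = 1" by (rule one) (auto simp: omitted_def)
    have s: "sumU \<phi> = real p" by (rule fU, rule one) (auto simp: omitted_def)
    from w s have "\<phi> TL = -1" "sumY \<phi> = real p - 1" using rU z by auto
    then show ?thesis
      by (intro fin[of "-1" "real p - 1" v0 y0 0, OF _ _ _ _ T]) (use i p in \<open>auto simp: facet_type_def\<close>)
  next
    case 4
    then obtain y0 u0 where i: "y0 < p" "u0 < p" "\<phi> (YL y0) \<noteq> 1" "\<phi> (UL u0) \<noteq> 1" by blast
    have T: "{l \<in> L. \<phi> l = 1} = L - omitted (YL y0) (UL u0) ZL \<sigma>"
      by (rule tight) (use i 4 in auto)
    have one: "\<phi> l = 1" if "l \<in> L - omitted (YL y0) (UL u0) ZL \<sigma>" for l using T that by blast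
    have w: "\<phi> TL = 1" by (rule one) (auto simp: omitted_def)
    have s: "sumV \<phi> = real K" by (rule fV, rule one) (auto simp: omitted_def)
    from w s have "\<phi> TL = 1" "sumY \<phi> = real p - 1" using rV by (auto simp: \<kappa>_real)
    then show ?thesis
      by (intro fin[of 1 "real p - 1" 0 y0 u0, OF _ _ _ _ T]) (use i p K in \<open>auto simp: facet_type_def\<close>)
  next
    case 5
    then obtain y0 u0 where i: "y0 < p" "u0 < p" "\<phi> (YL y0) \<noteq> 1" "\<phi> (UL u0) \<noteq> 1" by blast
    have T: "{l \<in> L. \<phi> l = 1} = L - omitted (YL y0) (UL u0) TL \<sigma>"
      by (rule tight) (use i 5 in auto)
    have one: "\<phi> l = 1" if "l \<in> L - omitted (YL y0) (UL u0) TL \<sigma>" for l using T that by blast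
    have w: "\<phi> ZL = 1" by (rule one) (auto simp: omitted_def)
    have s: "sumV \<phi> = real K" by (rule fV, rule one) (auto simp: omitted_def)
    from w s have "\<phi> TL = -1" "sumY \<phi> = - real \<kappa> - real K" using rV z by auto
    then show ?thesis
      by (intro fin[of "-1" "- real \<kappa> - real K" 0 y0 u0, OF _ _ _ _ T]) (use i p K in \<open>auto simp: facet_type_def\<close>)
  qed
qed

text \<open>
  A facet of each type contains \<open>z\<close> or \<open>t\<close>, or else all of \<open>Y\<close> and \<open>U\<close>, and always one of the
  full classes that express the sum over \<open>Y\<close>. This is what \<open>adm_subgroup\<close> needs.
\<close>

lemma phi_tight_generates:
  fixes f :: "lab \<Rightarrow> 'a::real_vector"
  assumes G: "add_subgroup G" and adm: "adm f" and ft: "facet_type \<tau> \<eta>" and c: "choice v0 y0 u0 \<sigma>"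
    and mem: "\<And>l. l \<in> L \<Longrightarrow> phi \<tau> \<eta> v0 y0 u0 \<sigma> l = 1 \<Longrightarrow> f l \<in> G" and l: "l \<in> L"
  shows "f l \<in> G"
proof -
  note G' = add_subgroupD[OF G]
  have rt: "f TL = - f ZL" and rY: "sumY f = real \<kappa> *\<^sub>R f TL - sumV f" and rY': "sumY f = sumU f - f ZL"
    using adm by (auto simp: adm_def eq_diff_eq add.commute)
  have pos: "real K \<ge> 2" "real p \<ge> 1" using K p by auto
  have memV: "f (VL i) \<in> G" if "i < K" "real \<kappa> * \<tau> - \<eta> = real K \<or> i \<noteq> v0" for i
    using that mem[of "VL i"] by auto
  have memY: "f (YL i) \<in> G" if "i < p" "\<eta> = real p \<or> i \<noteq> y0" for i
    using that mem[of "YL i"] by auto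
  have memU: "f (UL i) \<in> G" if "i < p" "\<eta> - \<tau> = real p \<or> i \<noteq> u0" for i
    using that mem[of "UL i"] by auto
  have sumV: "sumV f \<in> G" if "real \<kappa> * \<tau> - \<eta> = real K"
    unfolding sumV_def using that memV by (intro G'(5)) auto
  have sumY: "sumY f \<in> G" if "\<eta> = real p"
    unfolding sumY_def using that memY by (intro G'(5)) auto
  have sumU: "sumU f \<in> G" if "\<eta> - \<tau> = real p"
    unfolding sumU_def using that memU by (intro G'(5)) auto
  have "f TL \<in> G \<and> sumY f \<in> G"
  proof -
    consider "\<tau> = 1" "\<eta> = real p" | "\<tau> = 0" "\<eta> = real p" | "\<tau> = -1" "\<eta> = real p - 1"
      | "\<tau> = 1" "\<eta> = real p - 1" | "\<tau> = -1" "\<eta> = - real \<kappa> - real K"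
      using ft by (auto simp: facet_type_def)
    then show ?thesis
    proof cases
      case 1
      then show ?thesis using mem[of TL] sumY by simp
    next
      case 2
      then have "sumY f \<in> G" "sumU f \<in> G" using sumY sumU by simp_all
      moreover have "f TL = sumY f - sumU f" using rY' rt by simp
      ultimately show ?thesis using G'(4) by simp
    next
      case 3
      then have "f ZL \<in> G" "sumU f \<in> G" using mem[of ZL] sumU by simp_all
      then show ?thesis using rt rY' G'(2,4) by simp
    next
      case 4
      then have "f TL \<in> G" "sumV f \<in> G" using mem[of TL] sumV by (simp_all add: \<kappa>_real)
      then show ?thesis using rY G'(4,6) by simp
    next
      case 5
      then have "f TL \<in> G" "sumV f \<in> G" using mem[of ZL] sumV rt G'(2) by simp_all
      then show ?thesis using rY G'(4,6) by simp
    qed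
  qed
  then show ?thesis
    by (intro adm_subgroup[OF G adm _ _ c _ _ _ _ l]) (auto intro: memV memY memU mem)
qed

lemma adm_inner:
  fixes f :: "lab \<Rightarrow> 'a::real_inner"
  assumes "adm f"
  shows "adm (\<lambda>l. a \<bullet> f l)"
proof -
  have s: "sumV (\<lambda>l. a \<bullet> f l) = a \<bullet> sumV f" "sumY (\<lambda>l. a \<bullet> f l) = a \<bullet> sumY f"
    "sumU (\<lambda>l. a \<bullet> f l) = a \<bullet> sumU f" "sumS j (\<lambda>l. a \<bullet> f l) = a \<bullet> sumS j f" for j
    by (simp_all add: sumV_def sumY_def sumU_def sumS_def inner_sum_right)
  have r: "f ZL = - f TL" "sumV f + sumY f = real \<kappa> *\<^sub>R f TL" "sumU f = sumY f + f ZL"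
    "j < m \<Longrightarrow> sumS j f = real (\<alpha> j) *\<^sub>R sumY f + real (\<beta> j) *\<^sub>R sumU f" for j
    using assms by (auto simp: adm_def)
  show ?thesis
    unfolding adm_def s
    using r(1) arg_cong[OF r(2), of "\<lambda>x. a \<bullet> x"] arg_cong[OF r(3), of "\<lambda>x. a \<bullet> x"]
      arg_cong[OF r(4), of _ "\<lambda>x. a \<bullet> x"]
    by (simp add: inner_add_right inner_diff_right)
qed

end

text \<open>
  A realisation of the labels by lattice vectors that satisfy no relations besides the prescribed
  ones (\<open>vec_functional\<close>) and generate the lattice.
\<close>

locale fano_model = fano_params +
  fixes vec :: "lab \<Rightarrow> real ^ 'n"
  assumes vec_adm: "adm vec" and dim: "dimension = CARD('n)"
    and vec_lattice: "\<And>l. l \<in> L \<Longrightarrow> vec l \<in> int_lattice"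
    and vec_generates: "\<And>G. add_subgroup G \<Longrightarrow> vec ` L \<subseteq> G \<Longrightarrow> int_lattice \<subseteq> G"
    and vec_functional: "\<And>\<phi> :: lab \<Rightarrow> real. adm \<phi> \<Longrightarrow> \<exists>a. \<forall>l\<in>L. a \<bullet> vec l = \<phi> l"
begin

lemma inner_adm: "adm (\<lambda>l. a \<bullet> vec l)"
  by (rule adm_inner[OF vec_adm])

lemma lattice_basis_tight:
  assumes ft: "facet_type \<tau> \<eta>" and c: "choice v0 y0 u0 \<sigma>"
  shows "lattice_basis (vec ` {l \<in> L. phi \<tau> \<eta> v0 y0 u0 \<sigma> l = 1})" (is "lattice_basis (vec ` ?B)")
proof (rule lattice_basisI)
  have finB: "finite ?B" using finite_L by simp
  then show fin: "finite (vec ` ?B)" by simp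
  show "vec ` ?B \<subseteq> int_lattice" using vec_lattice by auto
  show "card (vec ` ?B) \<le> CARD('n)"
    using card_image_le[OF finB, of vec] card_phi_tight[OF ft c] dim by simp
  let ?G = "{x. \<exists>c :: real ^ 'n \<Rightarrow> int. x = (\<Sum>b\<in>vec ` ?B. of_int (c b) *\<^sub>R b)}"
  have G: "add_subgroup ?G"
    unfolding add_subgroup_def
  proof (intro conjI ballI)
    show "0 \<in> ?G" by (auto intro!: exI[of _ "\<lambda>_. 0"])
    fix x y assume "x \<in> ?G" "y \<in> ?G"
    then obtain c d :: "real ^ 'n \<Rightarrow> int" where "x = (\<Sum>b\<in>vec ` ?B. of_int (c b) *\<^sub>R b)"
      "y = (\<Sum>b\<in>vec ` ?B. of_int (d b) *\<^sub>R b)" by blast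
    then have "x - y = (\<Sum>b\<in>vec ` ?B. of_int (c b - d b) *\<^sub>R b)"
      by (simp add: sum_subtractf scaleR_left_diff_distrib)
    then show "x - y \<in> ?G" by (intro CollectI exI[of _ "\<lambda>b. c b - d b"])
  qed
  have "b \<in> ?G" if "b \<in> vec ` ?B" for b
  proof -
    have "b = (\<Sum>x\<in>vec ` ?B. of_int (if x = b then 1 else 0) *\<^sub>R x)"
      using that fin by (simp add: if_distrib[of "\<lambda>r. r *\<^sub>R _"] if_distrib[of of_int] cong: if_cong)
    then show ?thesis by (intro CollectI exI[of _ "\<lambda>x. if x = b then 1 else 0"])
  qed
  then have "vec l \<in> ?G" if "l \<in> L" for l
    by (intro phi_tight_generates[OF G vec_adm ft c _ that]) blast
  then have "int_lattice \<subseteq> ?G"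
    by (intro vec_generates[OF G]) blast
  then show "\<exists>c :: real ^ 'n \<Rightarrow> int. x = (\<Sum>b\<in>vec ` ?B. of_int (c b) *\<^sub>R b)" if "x \<in> int_lattice" for x
    using that by blast
qed

lemma tight_image: "{v \<in> vec ` L. a \<bullet> v = 1} = vec ` {l \<in> L. a \<bullet> vec l = 1}"
  by auto

lemma facet_functional:
  assumes "\<forall>v\<in>vec ` L. a \<bullet> v \<le> 1" "span {v \<in> vec ` L. a \<bullet> v = 1} = UNIV"
  shows "\<exists>\<tau> \<eta> v0 y0 u0 \<sigma>. facet_type \<tau> \<eta> \<and> choice v0 y0 u0 \<sigma> \<and>
    (\<forall>l\<in>L. a \<bullet> vec l = phi \<tau> \<eta> v0 y0 u0 \<sigma> l)"
proof -
  have le: "a \<bullet> vec l \<le> 1" if "l \<in> L" for l using assms(1) that by blast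
  have fin: "finite (vec ` {l \<in> L. a \<bullet> vec l = 1})" using finite_L by simp
  have "CARD('n) = dim (span {v \<in> vec ` L. a \<bullet> v = 1})"
    using assms(2) by simp
  also have "\<dots> \<le> card (vec ` {l \<in> L. a \<bullet> vec l = 1})"
    using dim_le_card'[OF fin] by (simp add: tight_image)
  also have "\<dots> \<le> card {l \<in> L. a \<bullet> vec l = 1}"
    using finite_L by (intro card_image_le) simp
  finally have card: "dimension \<le> card {l \<in> L. a \<bullet> vec l = 1}"
    using dim by simp
  show ?thesis
    using adm_facet_classification[OF inner_adm le card] .
qed

lemma phi_functional:
  assumes "choice v0 y0 u0 \<sigma>"
  obtains a where "\<And>l. l \<in> L \<Longrightarrow> a \<bullet> vec l = phi \<tau> \<eta> v0 y0 u0 \<sigma> l"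
  using vec_functional[OF phi_adm[OF assms]] by blast

lemma phi_eq_one_tight:
  assumes "\<And>l. l \<in> L \<Longrightarrow> a \<bullet> vec l = phi \<tau> \<eta> v0 y0 u0 \<sigma> l"
  shows "{v \<in> vec ` L. a \<bullet> v = 1} = vec ` {l \<in> L. phi \<tau> \<eta> v0 y0 u0 \<sigma> l = 1}"
  unfolding tight_image using assms by (intro arg_cong[of _ _ "image vec"]) auto

lemma vertex_in_facet:
  assumes "l \<in> L"
  obtains \<tau> \<eta> v0 y0 u0 \<sigma> where "facet_type \<tau> \<eta>" "choice v0 y0 u0 \<sigma>" "phi \<tau> \<eta> v0 y0 u0 \<sigma> l = 1"
proof -
  have c: "choice v0 0 0 (\<lambda>_. i)" if "v0 < K" "\<And>j. j < m \<Longrightarrow> i < q j" for v0 i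
    using that p by (simp add: choice_def)
  have q: "0 < q j" "j < m \<Longrightarrow> 1 < q j" for j using p \<alpha>\<beta>[of j] by (auto simp: q_def)
  have t: "facet_type 0 (real p)" "facet_type 1 (real p)" "facet_type (-1) (real p - 1)"
    by (auto simp: facet_type_def)
  show thesis
  proof (cases l)
    case (VL i)
    then show ?thesis
      using K by (intro that[OF t(1) c[of "if i = 0 then 1 else 0" 0]]) (auto simp: q)
  next
    case (SL j i)
    then show ?thesis
      using K q by (intro that[OF t(1) c[of 0 "if i = 0 then 1 else 0"]]) auto
  next
    case YL
    then show ?thesis using K by (intro that[OF t(1) c[of 0 0]]) (auto simp: q)
  next
    case UL
    then show ?thesis using K by (intro that[OF t(1) c[of 0 0]]) (auto simp: q)
  next
    case TL
    then show ?thesis using K by (intro that[OF t(2) c[of 0 0]]) (auto simp: q)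
  next
    case ZL
    then show ?thesis using K by (intro that[OF t(3) c[of 0 0]]) (auto simp: q)
  qed
qed

lemma span_vec: "span (vec ` L) = UNIV"
proof -
  have "add_subgroup (span (vec ` L))"
    by (auto simp: add_subgroup_def intro: span_diff span_zero)
  then have "int_lattice \<subseteq> span (vec ` L)"
    by (intro vec_generates span_superset)
  then show ?thesis
    using span_int_lattice span_minimal[of int_lattice "span (vec ` L)"] by auto
qed

text \<open>
  A functional that is nowhere positive vanishes at \<open>z = - t\<close> and \<open>t\<close>, hence at the \<open>v_i\<close> and \<open>y_i\<close>,
  whose sum is a multiple of \<open>t\<close>, then at the \<open>u_i\<close>, and finally at the blocks.
\<close>

lemma nonpositive_functional_zero:
  assumes "\<forall>v\<in>vec ` L. a \<bullet> v \<le> 0"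
  shows "a = 0"
proof -
  define \<phi> where "\<phi> l = a \<bullet> vec l" for l
  have adm: "adm \<phi>" unfolding \<phi>_def by (rule inner_adm)
  have le: "\<phi> l \<le> 0" if "l \<in> L" for l using assms that by (auto simp: \<phi>_def)
  have zero: "\<forall>i<N. g i = 0" if "(\<Sum>i<N. g i) = 0" "\<And>i. i < N \<Longrightarrow> g i \<le> 0" for g :: "nat \<Rightarrow> real" and N
    using sum_nonneg_eq_0_iff[of "{..<N}" "\<lambda>i. - g i"] that by (auto simp: sum_negf)
  have nonpos: "sumV \<phi> \<le> 0" "sumY \<phi> \<le> 0"
    using le by (auto simp: sumV_def sumY_def intro!: sum_nonpos)
  have t: "\<phi> TL = 0" "\<phi> ZL = 0"
    using adm le[of TL] le[of ZL] by (auto simp: adm_def)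
  then have s: "sumV \<phi> = 0" "sumY \<phi> = 0" using adm nonpos by (auto simp: adm_def)
  then have u: "sumU \<phi> = 0" using adm t by (auto simp: adm_def)
  have S: "sumS j \<phi> = 0" if "j < m" for j using adm s u that by (auto simp: adm_def)
  have "\<phi> l = 0" if "l \<in> L" for l
  proof (cases l)
    case (SL j i)
    then show ?thesis
      using zero[OF S[unfolded sumS_def], of j] le that by auto
  qed (use that t zero[OF s(1)[unfolded sumV_def]] zero[OF s(2)[unfolded sumY_def]]
      zero[OF u[unfolded sumU_def]] le in auto)
  then have "vec ` L \<subseteq> {x. a \<bullet> x = 0}" by (auto simp: \<phi>_def)
  then have "span (vec ` L) \<subseteq> {x. a \<bullet> x = 0}"
    by (intro span_minimal subspace_hyperplane)
  then have "a \<bullet> a = 0" using span_vec by blast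
  then show ?thesis by simp
qed

lemma model_smooth_fano:
  shows "smooth_fano (convex hull (vec ` L))" "vertices (convex hull (vec ` L)) = vec ` L"
proof -
  have 1: "finite (vec ` L)" "vec ` L \<subseteq> int_lattice" using finite_L vec_lattice by auto
  have 2: "\<exists>a. (\<forall>v\<in>vec ` L. a \<bullet> v \<le> 1) \<and> a \<bullet> w = 1 \<and> independent {v \<in> vec ` L. a \<bullet> v = 1}"
    if w: "w \<in> vec ` L" for w
  proof -
    obtain l where l: "l \<in> L" "w = vec l" using w by blast
    obtain \<tau> \<eta> v0 y0 u0 \<sigma> where f: "facet_type \<tau> \<eta>" "choice v0 y0 u0 \<sigma>" "phi \<tau> \<eta> v0 y0 u0 \<sigma> l = 1"
      using vertex_in_facet[OF l(1)] by blast
    obtain a where a: "\<And>l. l \<in> L \<Longrightarrow> a \<bullet> vec l = phi \<tau> \<eta> v0 y0 u0 \<sigma> l"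
      using phi_functional[OF f(2)] by blast
    have "independent {v \<in> vec ` L. a \<bullet> v = 1}"
      using lattice_basis_card_independent(2)[OF lattice_basis_tight[OF f(1,2)]] phi_eq_one_tight[of a, OF a]
      by simp
    then show ?thesis
      using a f l phi_le_one[OF f(1)] by (intro exI[of _ a]) auto
  qed
  have 3: "lattice_basis {v \<in> vec ` L. a \<bullet> v = 1}"
    if h: "\<forall>v\<in>vec ` L. a \<bullet> v \<le> 1" "span {v \<in> vec ` L. a \<bullet> v = 1} = UNIV" for a
  proof -
    obtain \<tau> \<eta> v0 y0 u0 \<sigma> where f: "facet_type \<tau> \<eta>" "choice v0 y0 u0 \<sigma>"
      "\<forall>l\<in>L. a \<bullet> vec l = phi \<tau> \<eta> v0 y0 u0 \<sigma> l"
      using facet_functional[OF h] by blast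
    then show ?thesis
      using lattice_basis_tight[OF f(1,2)] phi_eq_one_tight[of a] by simp
  qed
  note h = smooth_fano_hull[OF 1 nonpositive_functional_zero 2 3]
  show "smooth_fano (convex hull (vec ` L))" by (rule h(1))
  show "vertices (convex hull (vec ` L)) = vec ` L" by (rule h(2))
qed

end

section \<open>No vertex can be added\<close>

lemma ex_max_lessThan:
  fixes f :: "nat \<Rightarrow> real"
  assumes "0 < N"
  shows "\<exists>k<N. \<forall>i<N. f i \<le> f k"
proof -
  have "Max (f ` {..<N}) \<in> f ` {..<N}" using assms by (intro Max_in) auto
  then obtain k where "k < N" "f k = Max (f ` {..<N})" by auto
  then show ?thesis by (intro exI[of _ k]) auto
qed

lemma sum_mult_ones:
  fixes c f :: "nat \<Rightarrow> real"
  assumes "\<And>i. i < N \<Longrightarrow> i \<noteq> k \<Longrightarrow> f i = 1"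
  shows "(\<Sum>i<N. c i * f i) = c k * (\<Sum>i<N. f i) + (\<Sum>i<N. c i - c k)"
proof -
  have "c i * f i = c k * f i + (c i - c k)" if "i < N" for i
    using assms[OF that] by (cases "i = k") (auto simp: algebra_simps)
  then have "(\<Sum>i<N. c i * f i) = (\<Sum>i<N. c k * f i + (c i - c k))" by simp
  then show ?thesis by (simp add: sum.distrib sum_distrib_left)
qed

text \<open>
  The coefficients \<open>c\<close> of the new vertex \<open>w\<close> are with respect to all vertices, hence not unique. They
  make the heights of \<open>w\<close> computable from the values at the labels; where a particular choice
  matters, they are the coordinates in a cone that contains \<open>w\<close>.
\<close>

locale fano_added = fano_model K p m \<alpha> \<beta> vec
  for K p m \<alpha> \<beta> and vec :: "lab \<Rightarrow> real ^ 'n" +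
  fixes Q :: "(real ^ 'n) set" and w :: "real ^ 'n" and c :: "lab \<Rightarrow> real"
  assumes Q: "smooth_fano Q" and VQ: "vertices Q = insert w (vec ` L)"
    and w: "w \<notin> vec ` L" "w \<in> int_lattice" "w = (\<Sum>l\<in>L. c l *\<^sub>R vec l)"
begin

definition height :: "real \<Rightarrow> real \<Rightarrow> nat \<Rightarrow> nat \<Rightarrow> nat \<Rightarrow> (nat \<Rightarrow> nat) \<Rightarrow> real" where
  "height \<tau> \<eta> v0 y0 u0 \<sigma> = (\<Sum>l\<in>L. c l * phi \<tau> \<eta> v0 y0 u0 \<sigma> l)"

lemma phi_facet_normal:
  assumes ft: "facet_type \<tau> \<eta>" and ch: "choice v0 y0 u0 \<sigma>"
  obtains a where "facet_normal (convex hull (vec ` L)) a" "a \<bullet> w = height \<tau> \<eta> v0 y0 u0 \<sigma>"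
    "\<And>l. l \<in> L \<Longrightarrow> a \<bullet> vec l = phi \<tau> \<eta> v0 y0 u0 \<sigma> l"
    "tight (convex hull (vec ` L)) a = vec ` {l \<in> L. phi \<tau> \<eta> v0 y0 u0 \<sigma> l = 1}"
proof -
  obtain a where a: "\<And>l. l \<in> L \<Longrightarrow> a \<bullet> vec l = phi \<tau> \<eta> v0 y0 u0 \<sigma> l"
    using phi_functional[OF ch] by blast
  have t: "tight (convex hull (vec ` L)) a = vec ` {l \<in> L. phi \<tau> \<eta> v0 y0 u0 \<sigma> l = 1}"
    using phi_eq_one_tight[of a, OF a] by (simp add: tight_def model_smooth_fano(2))
  have "facet_normal (convex hull (vec ` L)) a"
    using lattice_basis_span[OF lattice_basis_tight[OF ft ch]] a phi_le_one[OF ft]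
    by (simp add: facet_normal_def t) (simp add: model_smooth_fano(2))
  moreover have "a \<bullet> w = height \<tau> \<eta> v0 y0 u0 \<sigma>"
    unfolding w(3) height_def using a by (simp add: inner_sum_right)
  ultimately show thesis using that[of a] a t by blast
qed

lemma horizon_labels:
  assumes ft: "facet_type \<tau> \<eta>" and ch: "choice v0 y0 u0 \<sigma>"
    and ft': "facet_type \<tau>' \<eta>'" and ch': "choice v0' y0' u0' \<sigma>'"
    and x: "x \<in> L" "phi \<tau> \<eta> v0 y0 u0 \<sigma> x = 1" "phi \<tau>' \<eta>' v0' y0' u0' \<sigma>' x \<noteq> 1"
    and ridge: "{l \<in> L. phi \<tau> \<eta> v0 y0 u0 \<sigma> l = 1} - {x} \<subseteq> {l \<in> L. phi \<tau>' \<eta>' v0' y0' u0' \<sigma>' l = 1}"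
    and vis: "height \<tau> \<eta> v0 y0 u0 \<sigma> > 0" "height \<tau>' \<eta>' v0' y0' u0' \<sigma>' \<le> 0"
  shows "height \<tau> \<eta> v0 y0 u0 \<sigma> - height \<tau>' \<eta>' v0' y0' u0' \<sigma>' = 1 - phi \<tau>' \<eta>' v0' y0' u0' \<sigma>' x"
    "height \<tau> \<eta> v0 y0 u0 \<sigma> \<ge> 2"
proof -
  let ?P = "convex hull (vec ` L)"
  obtain a where a: "facet_normal ?P a" "a \<bullet> w = height \<tau> \<eta> v0 y0 u0 \<sigma>"
    "\<And>l. l \<in> L \<Longrightarrow> a \<bullet> vec l = phi \<tau> \<eta> v0 y0 u0 \<sigma> l"
    "tight ?P a = vec ` {l \<in> L. phi \<tau> \<eta> v0 y0 u0 \<sigma> l = 1}"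
    using phi_facet_normal[OF ft ch] by blast
  obtain a' where a': "facet_normal ?P a'" "a' \<bullet> w = height \<tau>' \<eta>' v0' y0' u0' \<sigma>'"
    "\<And>l. l \<in> L \<Longrightarrow> a' \<bullet> vec l = phi \<tau>' \<eta>' v0' y0' u0' \<sigma>' l"
    "tight ?P a' = vec ` {l \<in> L. phi \<tau>' \<eta>' v0' y0' u0' \<sigma>' l = 1}"
    using phi_facet_normal[OF ft' ch'] by blast
  have x1: "vec x \<in> tight ?P a" using x a(4) by blast
  have x2: "vec x \<notin> tight ?P a'" using x a'(3) by (simp add: tight_def)
  have r: "tight ?P a - {vec x} \<subseteq> tight ?P a'"
    unfolding a(4) a'(4) using ridge by blast
  have V: "vertices Q = insert w (vertices ?P)" "w \<notin> vertices ?P"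
    using VQ w by (simp_all add: model_smooth_fano(2))
  note H = horizon_height_difference[OF model_smooth_fano(1) Q V w(2) a(1) a'(1) x1 x2 r]
  show "height \<tau> \<eta> v0 y0 u0 \<sigma> - height \<tau>' \<eta>' v0' y0' u0' \<sigma>' = 1 - phi \<tau>' \<eta>' v0' y0' u0' \<sigma>' x"
    "height \<tau> \<eta> v0 y0 u0 \<sigma> \<ge> 2"
    using H vis a(2) a'(2) a'(3)[OF x(1)] by simp_all
qed

text \<open>
  When the exchanged vertex \<open>x\<close> has height zero over the second facet, the heights of \<open>w\<close> would
  differ by one across a horizon wall. As visible heights are at least two, the wall is no horizon.
\<close>

lemma visible_step:
  assumes "facet_type \<tau> \<eta>" "choice v0 y0 u0 \<sigma>" "facet_type \<tau>' \<eta>'" "choice v0' y0' u0' \<sigma>'"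
    and "height \<tau> \<eta> v0 y0 u0 \<sigma> > 0"
    and "x \<in> L" "phi \<tau> \<eta> v0 y0 u0 \<sigma> x = 1" "phi \<tau>' \<eta>' v0' y0' u0' \<sigma>' x = 0"
    and "{l \<in> L. phi \<tau> \<eta> v0 y0 u0 \<sigma> l = 1} - {x} \<subseteq> {l \<in> L. phi \<tau>' \<eta>' v0' y0' u0' \<sigma>' l = 1}"
  shows "height \<tau>' \<eta>' v0' y0' u0' \<sigma>' > 0"
proof (rule ccontr)
  assume "\<not> ?thesis"
  then have "height \<tau>' \<eta>' v0' y0' u0' \<sigma>' \<le> 0" by simp
  from horizon_labels[OF assms(1-4,6,7) _ assms(9,5) this] assms(8) this
  show False by simp
qed

abbreviation visible :: "real \<Rightarrow> real \<Rightarrow> nat \<Rightarrow> nat \<Rightarrow> nat \<Rightarrow> (nat \<Rightarrow> nat) \<Rightarrow> bool" where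
  "visible \<tau> \<eta> v0 y0 u0 \<sigma> \<equiv> height \<tau> \<eta> v0 y0 u0 \<sigma> > 0"

lemma facet_types:
  "facet_type 1 (real p)" "facet_type 0 (real p)" "facet_type (-1) (real p - 1)"
  "facet_type 1 (real p - 1)" "facet_type (-1) (- real \<kappa> - real K)"
  by (auto simp: facet_type_def)

text \<open>
  Names refer to the five facet types in their order of definition. The exchanged vertices belong to
  the relations \<open>U + t = Y\<close>, \<open>V + Y = \<kappa> t\<close> and \<open>Y + z = U\<close>.
\<close>

lemma visible_neighbours:
  assumes ch: "choice v0 y0 u0 \<sigma>"
  shows
    visible_12: "visible 1 (real p) v0 y0 u0 \<sigma> \<Longrightarrow> visible 0 (real p) v0 y0 u0 \<sigma>" and
    visible_21: "visible 0 (real p) v0 y0 u0 \<sigma> \<Longrightarrow> visible 1 (real p) v0 y0 u0 \<sigma>" and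
    visible_14: "visible 1 (real p) v0 y0 u0 \<sigma> \<Longrightarrow> visible 1 (real p - 1) v0 y0 u0 \<sigma>" and
    visible_41: "visible 1 (real p - 1) v0 y0 u0 \<sigma> \<Longrightarrow> visible 1 (real p) v0 y0 u0 \<sigma>" and
    visible_23: "visible 0 (real p) v0 y0 u0 \<sigma> \<Longrightarrow> visible (-1) (real p - 1) v0 y0 u0 \<sigma>" and
    visible_32: "visible (-1) (real p - 1) v0 y0 u0 \<sigma> \<Longrightarrow> visible 0 (real p) v0 y0 u0 \<sigma>"
proof -
  have i: "v0 < K" "y0 < p" "u0 < p" using ch by (auto simp: choice_def)
  show "visible 0 (real p) v0 y0 u0 \<sigma>" if "visible 1 (real p) v0 y0 u0 \<sigma>"
    by (rule visible_step[OF facet_types(1) ch facet_types(2) ch that, where x = "TL"])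
      (use i in \<open>auto simp: phi_tight[OF ch] omitted_def \<kappa>_real\<close>)
  show "visible 1 (real p) v0 y0 u0 \<sigma>" if "visible 0 (real p) v0 y0 u0 \<sigma>"
    by (rule visible_step[OF facet_types(2) ch facet_types(1) ch that, where x = "UL u0"])
      (use i in \<open>auto simp: phi_tight[OF ch] omitted_def \<kappa>_real\<close>)
  show "visible 1 (real p - 1) v0 y0 u0 \<sigma>" if "visible 1 (real p) v0 y0 u0 \<sigma>"
    by (rule visible_step[OF facet_types(1) ch facet_types(4) ch that, where x = "YL y0"])
      (use i in \<open>auto simp: phi_tight[OF ch] omitted_def \<kappa>_real\<close>)
  show "visible 1 (real p) v0 y0 u0 \<sigma>" if "visible 1 (real p - 1) v0 y0 u0 \<sigma>"
    by (rule visible_step[OF facet_types(4) ch facet_types(1) ch that, where x = "VL v0"])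
      (use i in \<open>auto simp: phi_tight[OF ch] omitted_def \<kappa>_real\<close>)
  show "visible (-1) (real p - 1) v0 y0 u0 \<sigma>" if "visible 0 (real p) v0 y0 u0 \<sigma>"
    by (rule visible_step[OF facet_types(2) ch facet_types(3) ch that, where x = "YL y0"])
      (use i in \<open>auto simp: phi_tight[OF ch] omitted_def \<kappa>_real\<close>)
  show "visible 0 (real p) v0 y0 u0 \<sigma>" if "visible (-1) (real p - 1) v0 y0 u0 \<sigma>"
    by (rule visible_step[OF facet_types(3) ch facet_types(2) ch that, where x = "ZL"])
      (use i in \<open>auto simp: phi_tight[OF ch] omitted_def \<kappa>_real\<close>)
qed

text \<open>
  Facets of the second type contain all of \<open>Y\<close> and \<open>U\<close>. Hence their cones contain the right-hand
  sides of all block relations, and exchanging vertices of a block is a step of the above kind.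
\<close>

lemma visible_update:
  assumes ch: "choice v0 y0 u0 \<sigma>" and ji: "j < m" "i < q j" and vis: "visible 0 (real p) v0 y0 u0 \<sigma>"
  shows "visible 0 (real p) v0 y0 u0 (\<sigma>(j := i))"
proof (cases "i = \<sigma> j")
  case False
  have ch': "choice v0 y0 u0 (\<sigma>(j := i))" using ch ji by (simp add: choice_def)
  show ?thesis
    by (rule visible_step[OF facet_types(2) ch facet_types(2) ch' vis, where x = "SL j i"])
      (use ji False in \<open>auto simp: phi_tight[OF ch] phi_tight[OF ch'] omitted_def split: if_splits\<close>)
qed (use vis in simp)

lemma height_cong: "(\<And>l. l \<in> L \<Longrightarrow> phi \<tau> \<eta> v0 y0 u0 \<sigma> l = phi \<tau>' \<eta>' v0' y0' u0' \<sigma>' l) \<Longrightarrow>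
  height \<tau> \<eta> v0 y0 u0 \<sigma> = height \<tau>' \<eta>' v0' y0' u0' \<sigma>'"
  unfolding height_def by (intro sum.cong) auto

lemma visible_blocks:
  assumes ch: "choice v0 y0 u0 \<sigma>" and ch': "choice v0 y0 u0 \<sigma>'" and vis: "visible 0 (real p) v0 y0 u0 \<sigma>"
  shows "visible 0 (real p) v0 y0 u0 \<sigma>'"
proof -
  have "visible 0 (real p) v0 y0 u0 (\<lambda>j. if j < k then \<sigma>' j else \<sigma> j)" if "k \<le> m" for k
    using that
  proof (induction k)
    case (Suc k)
    have "(\<lambda>j. if j < Suc k then \<sigma>' j else \<sigma> j) = (\<lambda>j. if j < k then \<sigma>' j else \<sigma> j)(k := \<sigma>' k)"
      by (auto simp: less_Suc_eq)
    moreover have "choice v0 y0 u0 (\<lambda>j. if j < k then \<sigma>' j else \<sigma> j)"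
      using ch ch' by (simp add: choice_def)
    ultimately show ?case
      using visible_update[of v0 y0 u0 _ k "\<sigma>' k"] Suc ch' by (simp add: choice_def)
  qed (use vis in simp)
  moreover have "height 0 (real p) v0 y0 u0 (\<lambda>j. if j < m then \<sigma>' j else \<sigma> j) = height 0 (real p) v0 y0 u0 \<sigma>'"
    by (rule height_cong, case_tac l) auto
  ultimately show ?thesis by force
qed

text \<open>
  To exchange \<open>v0\<close>, the path leads through a facet of the fourth type, which contains all of \<open>V\<close> and so
  does not depend on \<open>v0\<close>. Facets of the second type do not depend on \<open>y0\<close> and \<open>u0\<close>.
\<close>

lemma visible_transfer:
  assumes ch: "choice v0 y0 u0 \<sigma>" and ch': "choice v0' y0' u0' \<sigma>'"
    and vis: "visible 0 (real p) v0 y0 u0 \<sigma>"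
  shows "visible 0 (real p) v0' y0' u0' \<sigma>'"
proof -
  have c1: "choice v0' y0 u0 \<sigma>" using ch ch' by (simp add: choice_def)
  have c2: "choice v0' y0 u0 \<sigma>'" using ch ch' by (simp add: choice_def)
  have "visible 1 (real p - 1) v0 y0 u0 \<sigma>"
    using visible_14[OF ch visible_21[OF ch vis]] .
  moreover have "height 1 (real p - 1) v0 y0 u0 \<sigma> = height 1 (real p - 1) v0' y0 u0 \<sigma>"
    by (rule height_cong, case_tac l) (auto simp: \<kappa>_real)
  ultimately have "visible 0 (real p) v0' y0 u0 \<sigma>"
    using visible_12[OF c1 visible_41[OF c1]] by simp
  then have "visible 0 (real p) v0' y0 u0 \<sigma>'"
    using visible_blocks[OF c1 c2] by simp
  moreover have "height 0 (real p) v0' y0 u0 \<sigma>' = height 0 (real p) v0' y0' u0' \<sigma>'"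
    by (rule height_cong, case_tac l) auto
  ultimately show ?thesis by simp
qed

text \<open>
  All values in a class except the one at the chosen vertex are one. So the class contributes its
  sum, which is linear in \<open>(\<tau>, \<eta>)\<close>, times the coefficient of the chosen vertex, plus a correction
  by the differences of the other coefficients to that one. These differences are not positive if the
  chosen coefficients are the largest ones.
\<close>

lemma height_affine:
  assumes ch: "choice v0 y0 u0 \<sigma>"
    and mx: "\<And>i. i < K \<Longrightarrow> c (VL i) \<le> c (VL v0)" "\<And>i. i < p \<Longrightarrow> c (YL i) \<le> c (YL y0)"
      "\<And>i. i < p \<Longrightarrow> c (UL i) \<le> c (UL u0)" "\<And>j i. j < m \<Longrightarrow> i < q j \<Longrightarrow> c (SL j i) \<le> c (SL j (\<sigma> j))"
  shows "\<exists>X Y E. E \<le> 0 \<and> (\<forall>\<tau> \<eta>. height \<tau> \<eta> v0 y0 u0 \<sigma> = X * \<tau> + Y * \<eta> + E)"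
proof -
  define A where "A = (\<Sum>j<m. c (SL j (\<sigma> j)) * real (\<alpha> j))"
  define B where "B = (\<Sum>j<m. c (SL j (\<sigma> j)) * real (\<beta> j))"
  define E where "E = (\<Sum>i<K. c (VL i) - c (VL v0)) + (\<Sum>i<p. c (YL i) - c (YL y0)) +
    (\<Sum>i<p. c (UL i) - c (UL u0)) + (\<Sum>j<m. \<Sum>i<q j. c (SL j i) - c (SL j (\<sigma> j)))"
  have "E \<le> 0"
    unfolding E_def by (intro add_nonpos_nonpos sum_nonpos) (auto simp: mx)
  moreover have "height \<tau> \<eta> v0 y0 u0 \<sigma> =
    (c (VL v0) * real \<kappa> - c (UL u0) + c TL - c ZL - B) * \<tau> + (c (YL y0) + c (UL u0) - c (VL v0) + A + B) * \<eta> + E"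
    for \<tau> \<eta>
  proof -
    let ?f = "phi \<tau> \<eta> v0 y0 u0 \<sigma>"
    have V: "sumV (\<lambda>l. c l * ?f l) = c (VL v0) * sumV ?f + (\<Sum>i<K. c (VL i) - c (VL v0))"
      unfolding sumV_def by (rule sum_mult_ones) simp
    have Y: "sumY (\<lambda>l. c l * ?f l) = c (YL y0) * sumY ?f + (\<Sum>i<p. c (YL i) - c (YL y0))"
      unfolding sumY_def by (rule sum_mult_ones) simp
    have U: "sumU (\<lambda>l. c l * ?f l) = c (UL u0) * sumU ?f + (\<Sum>i<p. c (UL i) - c (UL u0))"
      unfolding sumU_def by (rule sum_mult_ones) simp
    have S: "sumS j (\<lambda>l. c l * ?f l) = c (SL j (\<sigma> j)) * sumS j ?f + (\<Sum>i<q j. c (SL j i) - c (SL j (\<sigma> j)))" for j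
      unfolding sumS_def by (rule sum_mult_ones) simp
    have "(\<Sum>j<m. sumS j (\<lambda>l. c l * ?f l)) = (\<Sum>j<m. c (SL j (\<sigma> j)) * (real (\<alpha> j) * \<eta> + real (\<beta> j) * (\<eta> - \<tau>))) +
      (\<Sum>j<m. \<Sum>i<q j. c (SL j i) - c (SL j (\<sigma> j)))"
      unfolding S sum.distrib using phi_sums(4)[OF ch] by simp
    also have "(\<Sum>j<m. c (SL j (\<sigma> j)) * (real (\<alpha> j) * \<eta> + real (\<beta> j) * (\<eta> - \<tau>))) = A * \<eta> + B * (\<eta> - \<tau>)"
      by (simp add: A_def B_def sum_distrib_left sum_distrib_right sum.distrib algebra_simps sum_subtractf)
    finally show ?thesis
      unfolding height_def sum_L V Y U phi_sums(1-3)[OF ch] E_def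
      by (simp add: algebra_simps)
  qed
  ultimately show ?thesis by blast
qed

text \<open>
  Suppose that all facets of the first four types are visible. The pairs \<open>(\<tau>, \<eta>)\<close> of the third,
  fourth and fifth type have the origin as a combination with nonnegative weights
  \<open>K, \<kappa>, p - 1\<close>. Thus the same combination of their heights, with the missed vertices chosen to
  maximise the coefficients, is a multiple of the nonpositive constant term. But the first two
  heights are positive, and the third one cannot be negative: by the horizon condition it would be
  smaller by exactly two than the second one, which is at least two.
\<close>

lemma main_component_invisible:
  assumes ch: "choice v0 y0 u0 \<sigma>"
  shows "\<not> visible 0 (real p) v0 y0 u0 \<sigma>"
proof
  assume vis: "visible 0 (real p) v0 y0 u0 \<sigma>"
  obtain v y u where mx: "v < K" "\<forall>i<K. c (VL i) \<le> c (VL v)" "y < p" "\<forall>i<p. c (YL i) \<le> c (YL y)"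
    "u < p" "\<forall>i<p. c (UL i) \<le> c (UL u)"
    using ex_max_lessThan[of K "\<lambda>i. c (VL i)"] ex_max_lessThan[of p "\<lambda>i. c (YL i)"]
      ex_max_lessThan[of p "\<lambda>i. c (UL i)"] K p by fastforce
  have "\<exists>k<q j. \<forall>i<q j. c (SL j i) \<le> c (SL j k)" for j
    by (rule ex_max_lessThan) (simp add: q_def)
  then obtain s where s: "\<And>j. s j < q j" "\<And>j i. i < q j \<Longrightarrow> c (SL j i) \<le> c (SL j (s j))"
    by metis
  have ch': "choice v y u s" using mx s by (simp add: choice_def)
  have "\<exists>X Y E. E \<le> 0 \<and> (\<forall>\<tau> \<eta>. height \<tau> \<eta> v y u s = X * \<tau> + Y * \<eta> + E)"
    using mx s(2) by (intro height_affine[OF ch']) auto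
  then obtain X Y E where E: "E \<le> 0" "\<And>\<tau> \<eta>. height \<tau> \<eta> v y u s = X * \<tau> + Y * \<eta> + E"
    by blast
  have v2: "visible 0 (real p) v y u s" using visible_transfer[OF ch ch' vis] .
  have h3: "visible (-1) (real p - 1) v y u s" using visible_23[OF ch' v2] .
  have h4: "visible 1 (real p - 1) v y u s" using visible_14[OF ch' visible_21[OF ch' v2]] .
  have h5: "height (-1) (- real \<kappa> - real K) v y u s \<ge> 0"
  proof (rule ccontr)
    assume n: "\<not> ?thesis"
    have "height 1 (real p - 1) v y u s - height (-1) (- real \<kappa> - real K) v y u s =
        1 - phi (-1) (- real \<kappa> - real K) v y u s TL" "height 1 (real p - 1) v y u s \<ge> 2"
      by (rule horizon_labels[OF facet_types(4) ch' facet_types(5) ch', where x = TL];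
          use n h4 in \<open>auto simp: phi_tight[OF ch'] omitted_def\<close>)+
    then show False using n by simp
  qed
  have "real K * height (-1) (real p - 1) v y u s + real \<kappa> * height 1 (real p - 1) v y u s +
      (real p - 1) * height (-1) (- real \<kappa> - real K) v y u s = 2 * real \<kappa> * E"
    unfolding E(2) by (simp add: \<kappa>_real algebra_simps)
  moreover have "real K * height (-1) (real p - 1) v y u s > 0" using h3 K by simp
  moreover have "real \<kappa> * height 1 (real p - 1) v y u s \<ge> 0" using h4 by simp
  moreover have "(real p - 1) * height (-1) (- real \<kappa> - real K) v y u s \<ge> 0" using h5 p by simp
  moreover have "2 * real \<kappa> * E \<le> 0" using E(1) by (simp add: mult_nonneg_nonpos)
  ultimately show False by linarith
qed

lemma main_types_invisible:
  assumes ch: "choice v0 y0 u0 \<sigma>"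
  shows "\<not> visible 1 (real p) v0 y0 u0 \<sigma>" "\<not> visible (-1) (real p - 1) v0 y0 u0 \<sigma>"
    "\<not> visible 1 (real p - 1) v0 y0 u0 \<sigma>"
  using main_component_invisible[OF ch] visible_12[OF ch] visible_32[OF ch] visible_41[OF ch] by blast+

text \<open>
  If \<open>w\<close> is expressed by the vertices of the visible facet, then the horizon condition says that its
  coefficient at the exchanged vertex is one.
\<close>

lemma horizon_coefficient:
  assumes ft: "facet_type \<tau> \<eta>" and ch: "choice v0 y0 u0 \<sigma>"
    and ft': "facet_type \<tau>' \<eta>'" and ch': "choice v0' y0' u0' \<sigma>'"
    and x: "x \<in> L" "phi \<tau> \<eta> v0 y0 u0 \<sigma> x = 1" "phi \<tau>' \<eta>' v0' y0' u0' \<sigma>' x \<noteq> 1"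
    and ridge: "{l \<in> L. phi \<tau> \<eta> v0 y0 u0 \<sigma> l = 1} - {x} \<subseteq> {l \<in> L. phi \<tau>' \<eta>' v0' y0' u0' \<sigma>' l = 1}"
    and vis: "height \<tau> \<eta> v0 y0 u0 \<sigma> > 0" "height \<tau>' \<eta>' v0' y0' u0' \<sigma>' \<le> 0"
    and supp: "\<And>l. l \<in> L \<Longrightarrow> phi \<tau> \<eta> v0 y0 u0 \<sigma> l \<noteq> 1 \<Longrightarrow> c l = 0"
  shows "c x = 1"
proof -
  have "height \<tau> \<eta> v0 y0 u0 \<sigma> - height \<tau>' \<eta>' v0' y0' u0' \<sigma>' =
    (\<Sum>l\<in>L. c l * (phi \<tau> \<eta> v0 y0 u0 \<sigma> l - phi \<tau>' \<eta>' v0' y0' u0' \<sigma>' l))"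
    by (simp add: height_def sum_subtractf right_diff_distrib)
  also have "\<dots> = (\<Sum>l\<in>{x}. c l * (phi \<tau> \<eta> v0 y0 u0 \<sigma> l - phi \<tau>' \<eta>' v0' y0' u0' \<sigma>' l))"
  proof (rule sum.mono_neutral_right[OF finite_L])
    show "\<forall>l\<in>L - {x}. c l * (phi \<tau> \<eta> v0 y0 u0 \<sigma> l - phi \<tau>' \<eta>' v0' y0' u0' \<sigma>' l) = 0"
    proof
      fix l assume l: "l \<in> L - {x}"
      show "c l * (phi \<tau> \<eta> v0 y0 u0 \<sigma> l - phi \<tau>' \<eta>' v0' y0' u0' \<sigma>' l) = 0"
      proof (cases "phi \<tau> \<eta> v0 y0 u0 \<sigma> l = 1")
        case True
        then have "phi \<tau>' \<eta>' v0' y0' u0' \<sigma>' l = 1" using ridge l by blast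
        then show ?thesis using True by simp
      next
        case False
        then show ?thesis using supp l by simp
      qed
    qed
  qed (use x in auto)
  also have "\<dots> = c x * (1 - phi \<tau>' \<eta>' v0' y0' u0' \<sigma>' x)"
    using x(2) by simp
  finally have "c x * (1 - phi \<tau>' \<eta>' v0' y0' u0' \<sigma>' x) = 1 - phi \<tau>' \<eta>' v0' y0' u0' \<sigma>' x"
    using horizon_labels(1)[OF ft ch ft' ch' x ridge vis] by simp
  then show ?thesis using x(3) by simp
qed

text \<open>
  Suppose that \<open>w\<close> lies in the cone of a facet of the fifth type. Its walls opposite \<open>z\<close> and
  opposite each \<open>v_i\<close> lead to facets of the fourth and third type, which are invisible. So \<open>z\<close>
  and all \<open>v_i\<close> have coefficient one in \<open>w\<close>, whose height is therefore at least \<open>K + 1 \<ge> 3\<close>. But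
  across the wall opposite \<open>z\<close> the height drops by two only.
\<close>

lemma last_type_invisible:
  assumes ch: "choice v0 y0 u0 \<sigma>" and c0: "\<And>l. l \<in> L \<Longrightarrow> c l \<ge> 0"
    and supp: "\<And>l. l \<in> L \<Longrightarrow> phi (-1) (- real \<kappa> - real K) v0 y0 u0 \<sigma> l \<noteq> 1 \<Longrightarrow> c l = 0"
  shows "\<not> visible (-1) (- real \<kappa> - real K) v0 y0 u0 \<sigma>"
proof
  assume vis: "visible (-1) (- real \<kappa> - real K) v0 y0 u0 \<sigma>"
  have n4: "height 1 (real p - 1) v0 y0 u0 \<sigma> \<le> 0"
    using main_types_invisible(3)[OF ch] by simp
  have pos: "real K \<ge> 2" "real p \<ge> 1" using K p by auto
  have rZ: "{l \<in> L. phi (-1) (- real \<kappa> - real K) v0 y0 u0 \<sigma> l = 1} - {ZL} \<subseteq> {l \<in> L. phi 1 (real p - 1) v0 y0 u0 \<sigma> l = 1}"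
    by (auto simp: phi_tight[OF ch] omitted_def)
  have cZ: "c ZL = 1"
    by (rule horizon_coefficient[OF facet_types(5) ch facet_types(4) ch _ _ _ rZ vis n4 supp]) auto
  have d: "height (-1) (- real \<kappa> - real K) v0 y0 u0 \<sigma> - height 1 (real p - 1) v0 y0 u0 \<sigma> = 2"
    using horizon_labels(1)[OF facet_types(5) ch facet_types(4) ch _ _ _ rZ vis n4] by simp
  have cV: "c (VL v) = 1" if v: "v < K" for v
  proof -
    have ch': "choice v y0 u0 \<sigma>" using ch v by (simp add: choice_def)
    have "height (-1) (real p - 1) v y0 u0 \<sigma> \<le> 0"
      using main_types_invisible(2)[OF ch'] by simp
    moreover have "{l \<in> L. phi (-1) (- real \<kappa> - real K) v0 y0 u0 \<sigma> l = 1} - {VL v} \<subseteq> {l \<in> L. phi (-1) (real p - 1) v y0 u0 \<sigma> l = 1}"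
      by (auto simp: phi_tight[OF ch] phi_tight[OF ch'] omitted_def)
    ultimately show ?thesis
      by (intro horizon_coefficient[OF facet_types(5) ch facet_types(3) ch' _ _ _ _ vis _ supp])
        (use v pos in \<open>auto simp: \<kappa>_real\<close>)
  qed
  have "height (-1) (- real \<kappa> - real K) v0 y0 u0 \<sigma> = (\<Sum>l\<in>L. c l)"
    unfolding height_def using supp by (intro sum.cong) auto
  also have "\<dots> \<ge> (\<Sum>l\<in>insert ZL (VL ` {..<K}). c l)"
    using c0 by (intro sum_mono2 finite_L) auto
  also have "(\<Sum>l\<in>insert ZL (VL ` {..<K}). c l) = 1 + real K"
  proof -
    have "(\<Sum>l\<in>insert ZL (VL ` {..<K}). c l) = (\<Sum>l\<in>insert ZL (VL ` {..<K}). 1)"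
      using cZ cV by (intro sum.cong) auto
    moreover have "card (insert ZL (VL ` {..<K})) = Suc K"
      by (subst card_insert_disjoint) (auto simp: card_image inj_on_def)
    ultimately show ?thesis by simp
  qed
  finally show False using d n4 pos by linarith
qed

end

context fano_model
begin

lemma no_vertex_addable:
  assumes Q: "smooth_fano Q"
  shows "\<not> adds_vertex (convex hull (vec ` L)) Q"
proof
  let ?P = "convex hull (vec ` L)"
  assume "adds_vertex ?P Q"
  then obtain w where w: "w \<in> int_lattice" "w \<notin> vec ` L" "vertices Q = insert w (vec ` L)"
    by (auto simp: adds_vertex_def model_smooth_fano(2))
  have "w extreme_point_of Q" using w(3) by (auto simp: vertices_def)
  then have w0: "w \<noteq> 0"
    using smooth_fanoD(2)[OF Q] extreme_point_not_in_interior by blast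
  obtain a and d :: "real ^ 'n \<Rightarrow> int"
    where a: "facet_normal ?P a" and d: "w = (\<Sum>b\<in>tight ?P a. of_int (d b) *\<^sub>R b)"
      "\<And>b. b \<in> tight ?P a \<Longrightarrow> 0 \<le> d b"
    by (rule lattice_point_in_facet_cone[OF model_smooth_fano(1) w(1) w0]) blast
  have ta: "tight ?P a = {v \<in> vec ` L. a \<bullet> v = 1}"
    by (simp add: tight_def model_smooth_fano(2))
  have aL: "\<forall>v\<in>vec ` L. a \<bullet> v \<le> 1" "span {v \<in> vec ` L. a \<bullet> v = 1} = UNIV"
    using a by (simp_all add: facet_normal_def ta model_smooth_fano(2))
  obtain \<tau> \<eta> v0 y0 u0 \<sigma> where f: "facet_type \<tau> \<eta>" and ch: "choice v0 y0 u0 \<sigma>"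
    and al: "\<forall>l\<in>L. a \<bullet> vec l = phi \<tau> \<eta> v0 y0 u0 \<sigma> l"
    using facet_functional[OF aL] by blast
  define B where "B = {l \<in> L. phi \<tau> \<eta> v0 y0 u0 \<sigma> l = 1}"
  have tB: "tight ?P a = vec ` B"
    unfolding ta B_def using phi_eq_one_tight[of a \<tau> \<eta> v0 y0 u0 \<sigma>] al by simp
  have finB: "finite B" using finite_L by (simp add: B_def)
  have "card (vec ` B) = card B"
    using lattice_basis_card_independent(1)[OF lattice_basis_tight[OF f ch]] card_phi_tight[OF f ch] dim
    by (simp add: B_def)
  then have inj: "inj_on vec B"
    using eq_card_imp_inj_on[OF finB] by simp
  \<comment> \<open>the coordinates in the cone that contains \<open>w\<close>, extended by zero to all labels\<close>
  define c where "c l = (if l \<in> B then real_of_int (d (vec l)) else 0)" for l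
  have "w = (\<Sum>l\<in>B. of_int (d (vec l)) *\<^sub>R vec l)"
    by (subst d(1)) (simp add: tB sum.reindex[OF inj])
  also have "\<dots> = (\<Sum>l\<in>L. c l *\<^sub>R vec l)"
    using finite_L by (intro sum.mono_neutral_cong_left) (auto simp: B_def c_def)
  finally have wc: "w = (\<Sum>l\<in>L. c l *\<^sub>R vec l)" .
  interpret fano_added K p m \<alpha> \<beta> vec Q w c
    by unfold_locales (use Q w wc in auto)
  have c0: "c l \<ge> 0" for l
    using d(2) tB by (auto simp: c_def)
  have supp: "c l = 0" if "l \<in> L" "phi \<tau> \<eta> v0 y0 u0 \<sigma> l \<noteq> 1" for l
    using that by (auto simp: c_def B_def)
  have hc: "height \<tau> \<eta> v0 y0 u0 \<sigma> = (\<Sum>l\<in>L. c l)"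
    unfolding height_def using supp by (intro sum.cong) auto
  have vis: "visible \<tau> \<eta> v0 y0 u0 \<sigma>"
  proof (rule ccontr)
    assume "\<not> ?thesis"
    then have "(\<Sum>l\<in>L. c l) = 0"
      using hc sum_nonneg[of L c] c0 by force
    then have "\<forall>l\<in>L. c l = 0"
      using sum_nonneg_eq_0_iff[OF finite_L, of c] c0 by simp
    then show False using wc w0 by simp
  qed
  have "(\<tau>, \<eta>) \<noteq> (-1, - real \<kappa> - real K)"
    using last_type_invisible[OF ch] c0 supp vis by blast
  then show False
    using f vis main_component_invisible[OF ch] main_types_invisible[OF ch]
    by (auto simp: facet_type_def)
qed

end

section \<open>No vertex can be removed\<close>

context fano_params
begin

definition pairing :: "lab \<Rightarrow> lab \<Rightarrow> lab \<Rightarrow> real" where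
  "pairing a b l = (if l = a then 1 else 0) - (if l = b then 1 else 0)"

lemma pairing_adm:
  "i < K \<Longrightarrow> k < K \<Longrightarrow> adm (pairing (VL i) (VL k))"
  "i < p \<Longrightarrow> k < p \<Longrightarrow> adm (pairing (YL i) (YL k))"
  "i < p \<Longrightarrow> k < p \<Longrightarrow> adm (pairing (UL i) (UL k))"
  "j < m \<Longrightarrow> i < q j \<Longrightarrow> k < q j \<Longrightarrow> adm (pairing (SL j i) (SL j k))"
proof -
  have "(\<Sum>i'<q j'. if j' = j \<and> i' = i then 1 else 0) = (if j' = j then (1::real) else 0)" if "i < q j" for i j j'
    using that by (cases "j' = j") auto
  then show "j < m \<Longrightarrow> i < q j \<Longrightarrow> k < q j \<Longrightarrow> adm (pairing (SL j i) (SL j k))"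
    by (auto simp: adm_def pairing_def sumV_def sumY_def sumU_def sumS_def sum_subtractf)
qed (auto simp: adm_def pairing_def sumV_def sumY_def sumU_def sumS_def sum_subtractf)

text \<open>
  Only the sums over the classes enter the relations, so a vertex that is not alone in its class can
  be paired with another one of that class. The vertex \<open>z\<close> is separated by a functional that is
  negative at \<open>t\<close>; its values at the other vertices are chosen to satisfy the relations.
\<close>

lemma separating_functional:
  assumes l: "l \<in> L" "l \<noteq> TL" and p2: "2 \<le> p \<or> l \<notin> {YL 0, UL 0}"
  obtains \<phi> :: "lab \<Rightarrow> real" where "adm \<phi>" "\<phi> l > 0" "\<And>l'. l' \<in> L \<Longrightarrow> l' \<noteq> l \<Longrightarrow> \<phi> l' \<le> 0"
proof -
  have other: "\<exists>k<N. k \<noteq> i" if "2 \<le> N" for N i :: nat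
    using that by (intro exI[of _ "if i = 0 then 1 else 0"]) auto
  note witness = that
  have pair: thesis if b: "adm (pairing l b)" "b \<noteq> l" for b
  proof (rule witness)
    show "adm (pairing l b)" using b(1) .
  qed (use b(2) in \<open>auto simp: pairing_def\<close>)
  show thesis
  proof (cases l)
    case (VL i)
    then show ?thesis using other[of K i] K pairing_adm(1)[of i] pair l by auto
  next
    case (YL i)
    then have "i < p" using l by simp
    then have "2 \<le> p" using p2 YL by (cases i) auto
    then show ?thesis using other[of p i] pairing_adm(2)[of i] pair l YL by auto
  next
    case (UL i)
    then have "i < p" using l by simp
    then have "2 \<le> p" using p2 UL by (cases i) auto
    then show ?thesis using other[of p i] pairing_adm(3)[of i] pair l UL by auto
  next
    case (SL j i)
    then have "2 \<le> q j" using \<alpha>\<beta>[of j] p l by (simp add: q_def Suc_le_eq)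
    then show ?thesis using other[of "q j" i] pairing_adm(4)[of j i] pair l SL by auto
  next
    case ZL
    define \<phi> :: "lab \<Rightarrow> real" where "\<phi> l = (case l of ZL \<Rightarrow> 1 | TL \<Rightarrow> -1
      | VL i \<Rightarrow> if i = 0 then 1 - real \<kappa> else 0 | YL i \<Rightarrow> if i = 0 then -1 else 0 | UL i \<Rightarrow> 0
      | SL j i \<Rightarrow> if i = 0 then - real (\<alpha> j) else 0)" for l
    have "adm \<phi>"
      using K p by (auto simp: adm_def \<phi>_def sumV_def sumY_def sumU_def sumS_def q_def)
    moreover have "\<phi> l' \<le> 0" if "l' \<noteq> ZL" for l'
      using that K p by (cases l') (auto simp: \<phi>_def \<kappa>_real)
    ultimately show thesis using that[of \<phi>] ZL by (auto simp: \<phi>_def)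
  qed (use l in auto)
qed

end

context fano_model
begin

text \<open>
  Separating functionals distinguish their vertex from all others. The vertices that may lack one,
  \<open>t\<close>, \<open>y\<close> and \<open>u\<close>, are distinguished by facets of the first two types.
\<close>

lemma inj_vec: "inj_on vec L"
proof (rule inj_onI, rule ccontr)
  fix l l' assume l: "l \<in> L" "l' \<in> L" "vec l = vec l'" "l \<noteq> l'"
  have sep: False if k: "k \<in> L" "k' \<in> L" "vec k = vec k'" "k \<noteq> k'" "k \<noteq> TL" "2 \<le> p \<or> k \<notin> {YL 0, UL 0}" for k k'
  proof -
    obtain \<phi> :: "lab \<Rightarrow> real" where \<phi>: "adm \<phi>" "\<phi> k > 0" "\<And>l. l \<in> L \<Longrightarrow> l \<noteq> k \<Longrightarrow> \<phi> l \<le> 0"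
      using separating_functional[OF k(1,5,6)] by blast
    obtain a where "\<forall>l\<in>L. a \<bullet> vec l = \<phi> l" using vec_functional[OF \<phi>(1)] by blast
    then have "\<phi> k = \<phi> k'" using k by metis
    then show False using \<phi>(2) \<phi>(3)[of k'] k by auto
  qed
  have ch: "choice 0 0 0 (\<lambda>_. 0)" using K p by (simp add: choice_def q_def)
  have eq: "phi \<tau> \<eta> 0 0 0 (\<lambda>_. 0) l = phi \<tau> \<eta> 0 0 0 (\<lambda>_. 0) l'" for \<tau> \<eta>
    using phi_functional[OF ch, of \<tau> \<eta>] l by metis
  have "l \<in> {TL, YL 0, UL 0}" "l' \<in> {TL, YL 0, UL 0}"
    using sep[of l l'] sep[of l' l] l by auto
  then show False
    using eq[of 0 "real p"] eq[of 1 "real p"] l(4) by auto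
qed

lemma tight_dependent:
  assumes Q: "smooth_fano Q" and f: "facet_normal Q f"
    and x: "x \<in> tight Q f" and y: "y \<in> tight Q f" "y \<noteq> x"
    and s: "\<And>i. i \<in> I \<Longrightarrow> s i \<in> tight Q f" "\<And>i. i \<in> I \<Longrightarrow> s i \<noteq> x"
  shows "x \<noteq> (\<Sum>i\<in>I. s i) - r *\<^sub>R y"
proof
  assume "x = (\<Sum>i\<in>I. s i) - r *\<^sub>R y"
  moreover have "(\<Sum>i\<in>I. s i) - r *\<^sub>R y \<in> span (tight Q f - {x})"
    using y s by (intro span_diff span_sum span_mul span_base) auto
  ultimately have "x \<in> span (tight Q f - {x})" by simp
  then show False
    using lattice_basis_card_independent(2)[OF smooth_fanoD(5)[OF Q f]] x by (auto simp: dependent_def)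
qed

text \<open>
  Let \<open>l\<close> be the label of a removed vertex without separating functional. It has height at least two
  over some facet of the smaller polytope, while all other vertices have height at most one. From
  \<open>V + Y = \<kappa> t\<close> one gets \<open>2 \<kappa> \<le> K + p = \<kappa> + 1\<close> if \<open>t\<close> is removed. In the other two cases the
  relation \<open>y = u + t\<close> or \<open>u = y + z\<close> shows that the height is exactly two and that both summands
  lie in the facet. A block relation with the removed vertex on its right then has a right-hand side
  whose height is at least the number of elements of the block, so the block lies in the facet as
  well; this contradicts the linear independence of the vertices of the facet.
\<close>

lemma no_vertex_removable:
  assumes crit: "2 \<le> p \<or> ((\<exists>j<m. 1 \<le> \<alpha> j) \<and> (\<exists>j<m. 1 \<le> \<beta> j))"
    and Q: "smooth_fano Q"
  shows "\<not> adds_vertex Q (convex hull (vec ` L))"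
proof
  assume "adds_vertex Q (convex hull (vec ` L))"
  then obtain w where w: "w \<in> int_lattice" "w \<notin> vertices Q" "vec ` L = insert w (vertices Q)"
    by (auto simp: adds_vertex_def model_smooth_fano(2))
  then obtain l where l: "l \<in> L" "w = vec l" by blast
  have VQ: "vec l' \<in> vertices Q" if "l' \<in> L" "l' \<noteq> l" for l'
    using that w(3) l inj_onD[OF inj_vec, of l' l] by auto
  have VQ': "\<exists>l'\<in>L. l' \<noteq> l \<and> v = vec l'" if v: "v \<in> vertices Q" for v
  proof -
    obtain l' where "l' \<in> L" "v = vec l'" using v w(3) by blast
    then show ?thesis using v w(2) l(2) by (intro bexI[of _ l']) auto
  qed
  have "w \<in> vec ` L" using w(3) by blast
  then have "w \<in> vertices (convex hull (vec ` L))" by (simp only: model_smooth_fano(2))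
  then have "w extreme_point_of (convex hull (vec ` L))" by (simp add: vertices_def)
  then have w0: "w \<noteq> 0"
    using smooth_fanoD(2)[OF model_smooth_fano(1)] extreme_point_not_in_interior by blast
  have "\<not> (l \<noteq> TL \<and> (2 \<le> p \<or> l \<notin> {YL 0, UL 0}))"
  proof
    assume "l \<noteq> TL \<and> (2 \<le> p \<or> l \<notin> {YL 0, UL 0})"
    then obtain \<phi> :: "lab \<Rightarrow> real" where \<phi>: "adm \<phi>" "\<phi> l > 0" "\<And>l'. l' \<in> L \<Longrightarrow> l' \<noteq> l \<Longrightarrow> \<phi> l' \<le> 0"
      using separating_functional[OF l(1)] by blast
    obtain a where a: "\<forall>l\<in>L. a \<bullet> vec l = \<phi> l" using vec_functional[OF \<phi>(1)] by blast
    obtain f and d :: "real ^ 'n \<Rightarrow> int" where d: "w = (\<Sum>b\<in>tight Q f. of_int (d b) *\<^sub>R b)"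
      "\<And>b. b \<in> tight Q f \<Longrightarrow> 0 \<le> d b"
      by (rule lattice_point_in_facet_cone[OF Q w(1) w0]) blast
    have "a \<bullet> w = (\<Sum>b\<in>tight Q f. of_int (d b) * (a \<bullet> b))"
      by (subst d(1)) (simp add: inner_sum_right)
    also have "\<dots> \<le> 0"
    proof (intro sum_nonpos mult_nonneg_nonpos)
      fix b assume b: "b \<in> tight Q f"
      then obtain l' where "l' \<in> L" "l' \<noteq> l" "b = vec l'"
        using VQ' tight_subset by blast
      then show "a \<bullet> b \<le> 0" using a \<phi>(3) by simp
      show "0 \<le> real_of_int (d b)" using d(2)[OF b] by simp
    qed
    finally show False using a l \<phi>(2) by simp
  qed
  then have lc: "l = TL \<or> p = 1 \<and> (l = YL 0 \<or> l = UL 0)"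
    using p by auto
  obtain f where f: "facet_normal Q f" "f \<bullet> w \<ge> 2"
    using non_vertex_height[OF Q w(1) w0 w(2)] by blast
  define \<phi> where "\<phi> l = f \<bullet> vec l" for l
  have adm: "adm \<phi>" unfolding \<phi>_def by (rule inner_adm)
  have le: "\<phi> l' \<le> 1" if "l' \<in> L" "l' \<noteq> l" for l'
    using facet_normal_le[OF f(1) VQ[OF that]] by (simp add: \<phi>_def)
  have ge: "\<phi> l \<ge> 2" using f(2) l by (simp add: \<phi>_def)
  have tight: "vec l' \<in> tight Q f" if "l' \<in> L" "l' \<noteq> l" "\<phi> l' = 1" for l'
    using VQ[OF that(1,2)] that(3) by (simp add: tight_def \<phi>_def)
  have sumS_bound: "sumS j \<phi> \<le> real (q j)" "sumS j \<phi> = real (q j) \<Longrightarrow> i < q j \<Longrightarrow> \<phi> (SL j i) = 1"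
    if "j < m" for i j
  proof -
    have le1: "\<phi> (SL j i) \<le> 1" if "i < q j" for i
      using le[of "SL j i"] lc that \<open>j < m\<close> by auto
    then show "sumS j \<phi> \<le> real (q j)"
      using sum_bounded_above[of "{..<q j}" "\<lambda>i. \<phi> (SL j i)" 1] by (simp add: sumS_def)
    assume "sumS j \<phi> = real (q j)" "i < q j"
    then have "(\<Sum>i<q j. 1 - \<phi> (SL j i)) = 0" by (simp add: sumS_def sum_subtractf)
    then show "\<phi> (SL j i) = 1"
      using sum_nonneg_eq_0_iff[of "{..<q j}" "\<lambda>i. 1 - \<phi> (SL j i)"] le1 \<open>i < q j\<close> by auto
  qed
  have rel: "\<phi> ZL = - \<phi> TL" "sumV \<phi> + sumY \<phi> = real \<kappa> * \<phi> TL" "sumU \<phi> = sumY \<phi> + \<phi> ZL"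
    "\<And>j. j < m \<Longrightarrow> sumS j \<phi> = real (\<alpha> j) * sumY \<phi> + real (\<beta> j) * sumU \<phi>"
    using adm by (auto simp: adm_def)
  have vrel: "vec ZL = - vec TL" "sumU vec = sumY vec + vec ZL"
    "\<And>j. j < m \<Longrightarrow> sumS j vec = real (\<alpha> j) *\<^sub>R sumY vec + real (\<beta> j) *\<^sub>R sumU vec"
    using vec_adm by (auto simp: adm_def)
  have mem: "YL 0 \<in> L" "UL 0 \<in> L" using p by auto
  from lc consider "l = TL" | "p = 1" "l = YL 0" | "p = 1" "l = UL 0" by blast
  then show False
  proof cases
    case 1
    have "sumV \<phi> \<le> real K" "sumY \<phi> \<le> real p"
      using sum_bounded_above[of "{..<K}" "\<lambda>i. \<phi> (VL i)" 1] sum_bounded_above[of "{..<p}" "\<lambda>i. \<phi> (YL i)" 1]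
        le 1 by (auto simp: sumV_def sumY_def)
    moreover have "real \<kappa> * \<phi> TL \<ge> real \<kappa> * 2"
      using ge 1 by (intro mult_left_mono) auto
    ultimately have "real \<kappa> * 2 \<le> real K + real p" using rel(2) by linarith
    then show False using K p by (simp add: \<kappa>_real)
  next
    case 2
    have s: "sumY g = g (YL 0)" "sumU g = g (UL 0)" for g :: "lab \<Rightarrow> 'b::comm_monoid_add"
      unfolding sumY_def sumU_def unfolding 2(1) by simp_all
    have q1: "real (q j) = real (\<alpha> j) + real (\<beta> j) + 1" for j
      unfolding q_def unfolding 2(1) by simp
    obtain j where j: "j < m" "1 \<le> \<alpha> j" using crit 2 by auto
    have h: "\<phi> TL = 1" "\<phi> (UL 0) = 1" "\<phi> (YL 0) = 2"
      using rel(1,3) le[of TL] le[of "UL 0"] ge 2(2) mem unfolding s by auto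
    have "sumS j \<phi> = real (q j) + (real (\<alpha> j) - 1)"
      using rel(4)[OF j(1)] h unfolding s by (simp add: q1)
    then have a1: "\<alpha> j = 1" and "sumS j \<phi> = real (q j)"
      using sumS_bound(1)[OF j(1)] j by auto
    then have S: "\<phi> (SL j i) = 1" if "i < q j" for i
      using sumS_bound(2)[OF j(1)] that by blast
    have "vec TL \<noteq> (\<Sum>i<q j. vec (SL j i)) - (1 + real (\<beta> j)) *\<^sub>R vec (UL 0)"
      using S h j 2(2) mem inj_onD[OF inj_vec, of "UL 0" TL] inj_onD[OF inj_vec, of "SL j _" TL]
      by (intro tight_dependent[OF Q f(1)] tight) auto
    moreover have "(\<Sum>i<q j. vec (SL j i)) = vec (YL 0) + real (\<beta> j) *\<^sub>R vec (UL 0)"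
      using vrel(3)[OF j(1)] a1 unfolding s by (simp add: sumS_def)
    moreover have "vec (YL 0) = vec (UL 0) + vec TL"
      using vrel(1,2) unfolding s by simp
    ultimately show False by (simp add: scaleR_left_distrib)
  next
    case 3
    have s: "sumY g = g (YL 0)" "sumU g = g (UL 0)" for g :: "lab \<Rightarrow> 'b::comm_monoid_add"
      unfolding sumY_def sumU_def unfolding 3(1) by simp_all
    have q1: "real (q j) = real (\<alpha> j) + real (\<beta> j) + 1" for j
      unfolding q_def unfolding 3(1) by simp
    obtain j where j: "j < m" "1 \<le> \<beta> j" using crit 3 by auto
    have h: "\<phi> ZL = 1" "\<phi> (YL 0) = 1" "\<phi> (UL 0) = 2"
      using rel(3) le[of ZL] le[of "YL 0"] ge 3(2) mem unfolding s by auto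
    have "sumS j \<phi> = real (q j) + (real (\<beta> j) - 1)"
      using rel(4)[OF j(1)] h unfolding s by (simp add: q1)
    then have b1: "\<beta> j = 1" and "sumS j \<phi> = real (q j)"
      using sumS_bound(1)[OF j(1)] j by auto
    then have S: "\<phi> (SL j i) = 1" if "i < q j" for i
      using sumS_bound(2)[OF j(1)] that by blast
    have "vec ZL \<noteq> (\<Sum>i<q j. vec (SL j i)) - (1 + real (\<alpha> j)) *\<^sub>R vec (YL 0)"
      using S h j 3(2) mem inj_onD[OF inj_vec, of "YL 0" ZL] inj_onD[OF inj_vec, of "SL j _" ZL]
      by (intro tight_dependent[OF Q f(1)] tight) auto
    moreover have "(\<Sum>i<q j. vec (SL j i)) = real (\<alpha> j) *\<^sub>R vec (YL 0) + vec (UL 0)"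
      using vrel(3)[OF j(1)] b1 unfolding s by (simp add: sumS_def)
    moreover have "vec (UL 0) = vec (YL 0) + vec ZL"
      using vrel(2) unfolding s by simp
    ultimately show False by (simp add: scaleR_left_distrib)
  qed
qed

lemma card_vertices: "card (vertices (convex hull (vec ` L))) = CARD('n) + 3 + m"
  using card_image[OF inj_vec] card_L dim by (simp add: model_smooth_fano(2))

end

section \<open>Realisation and choice of parameters\<close>

lemma add_subgroup_int_scale:
  fixes G :: "'a::real_vector set"
  assumes "add_subgroup G" "x \<in> G"
  shows "of_int k *\<^sub>R x \<in> G"
proof (cases "0 \<le> k")
  case True
  then show ?thesis using add_subgroupD(6)[OF assms, of "nat k"] by simp
next
  case False
  then show ?thesis using add_subgroupD(6)[OF assms(1) add_subgroupD(2)[OF assms], of "nat (- k)"] by simp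
qed

lemma sum_if_zero:
  fixes g :: "nat \<Rightarrow> 'a::ab_group_add"
  assumes "0 < N"
  shows "(\<Sum>i<N. if i = 0 then X - (\<Sum>i=1..<N. g i) else g i) = X"
proof -
  have "{..<N} = insert 0 {1..<N}" using assms by auto
  then have "(\<Sum>i<N. if i = 0 then X - (\<Sum>i=1..<N. g i) else g i) =
    (X - (\<Sum>i=1..<N. g i)) + (\<Sum>i=1..<N. if i = 0 then X - (\<Sum>i=1..<N. g i) else g i)"
    by simp
  also have "(\<Sum>i=1..<N. if i = 0 then X - (\<Sum>i=1..<N. g i) else g i) = (\<Sum>i=1..<N. g i)"
    by (intro sum.cong) auto
  finally show ?thesis by simp
qed

context fano_params
begin

text \<open>
  The vertices of one facet of the fourth type; they are realised by the unit vectors.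
\<close>

definition base :: "lab set" where "base = L - omitted (YL 0) (UL 0) ZL (\<lambda>_. 0)"

text \<open>
  The admissible family with given values on \<open>base\<close>: the values at the three labels
  \<open>ZL\<close>, \<open>YL 0\<close>, \<open>UL 0\<close> and at the first label of each block are computed from the relations, where
  \<open>y\<close> and \<open>u\<close> are the sums over the corresponding classes.
\<close>

definition extend :: "(lab \<Rightarrow> 'a::real_vector) \<Rightarrow> lab \<Rightarrow> 'a" where
  "extend g l = (let y = real \<kappa> *\<^sub>R g TL - sumV g; u = y - g TL in
     case l of TL \<Rightarrow> g TL | ZL \<Rightarrow> - g TL | VL i \<Rightarrow> g (VL i)
     | YL i \<Rightarrow> if i = 0 then y - (\<Sum>i=1..<p. g (YL i)) else g (YL i)
     | UL i \<Rightarrow> if i = 0 then u - (\<Sum>i=1..<p. g (UL i)) else g (UL i)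
     | SL j i \<Rightarrow> if i = 0 then real (\<alpha> j) *\<^sub>R y + real (\<beta> j) *\<^sub>R u - (\<Sum>i=1..<q j. g (SL j i)) else g (SL j i))"

lemma extend_adm: "adm (extend g)"
proof -
  have "0 < p" "0 < q j" for j using p by (auto simp: q_def)
  then have "sumY (extend g) = real \<kappa> *\<^sub>R g TL - sumV g"
    "sumU (extend g) = real \<kappa> *\<^sub>R g TL - sumV g - g TL"
    "sumS j (extend g) = real (\<alpha> j) *\<^sub>R (real \<kappa> *\<^sub>R g TL - sumV g) +
      real (\<beta> j) *\<^sub>R (real \<kappa> *\<^sub>R g TL - sumV g - g TL)" for j
    by (simp_all add: sumY_def sumU_def sumS_def extend_def Let_def sum_if_zero)
  moreover have "sumV (extend g) = sumV g"
    by (simp add: sumV_def extend_def)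
  ultimately show ?thesis by (simp add: adm_def) (simp add: extend_def Let_def)
qed

lemma extend_base: "l \<in> base \<Longrightarrow> extend g l = g l"
  by (cases l) (auto simp: base_def omitted_def extend_def Let_def)

lemma base_choice: "choice 0 0 0 (\<lambda>_. 0)"
  using K p by (simp add: choice_def q_def)

lemma card_base: "card base = dimension"
  unfolding base_def using p by (intro card_L_omitted) (auto simp: q_def)

lemma adm_base_subgroup:
  fixes f :: "lab \<Rightarrow> 'a::real_vector"
  assumes G: "add_subgroup G" and adm: "adm f" and b: "\<And>l. l \<in> base \<Longrightarrow> f l \<in> G" and l: "l \<in> L"
  shows "f l \<in> G"
proof -
  have "sumY f = real \<kappa> *\<^sub>R f TL - sumV f"
    using adm by (auto simp: adm_def eq_diff_eq add.commute)
  moreover have t: "f TL \<in> G" by (rule b) (auto simp: base_def omitted_def)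
  moreover have "sumV f \<in> G"
    unfolding sumV_def by (intro add_subgroupD(5)[OF G] b) (auto simp: base_def omitted_def)
  ultimately have "sumY f \<in> G" using add_subgroupD(4,6)[OF G] by simp
  then show ?thesis
    by (intro adm_subgroup[OF G adm t _ base_choice _ _ _ _ l] b) (auto simp: base_def omitted_def)
qed

lemma adm_base_eq:
  fixes \<phi> \<psi> :: "lab \<Rightarrow> 'a::real_vector"
  assumes adm: "adm \<phi>" "adm \<psi>" and eq: "\<And>l. l \<in> base \<Longrightarrow> \<phi> l = \<psi> l" and l: "l \<in> L"
  shows "\<phi> l = \<psi> l"
proof -
  have t: "\<phi> TL = \<psi> TL" by (rule eq) (auto simp: base_def omitted_def)
  have v: "sumV \<phi> = sumV \<psi>"
    unfolding sumV_def by (intro sum.cong refl eq) (auto simp: base_def omitted_def)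
  have "sumV \<phi> + sumY \<phi> = sumV \<psi> + sumY \<psi>" using adm t by (simp add: adm_def)
  then have "sumY \<phi> = sumY \<psi>" using v by simp
  then show ?thesis
    by (intro adm_eqI[OF adm t _ base_choice _ _ _ _ l] eq) (auto simp: base_def omitted_def)
qed

lemma model_exists:
  assumes dim: "dimension = CARD('n::finite)"
  shows "\<exists>vec :: lab \<Rightarrow> real ^ 'n. fano_model K p m \<alpha> \<beta> vec"
proof -
  have fin: "finite base" using finite_L by (simp add: base_def)
  obtain e :: "lab \<Rightarrow> 'n" where e: "bij_betw e base UNIV"
    using finite_same_card_bij[OF fin finite, of "UNIV :: 'n set"] card_base dim by auto
  define vec :: "lab \<Rightarrow> real ^ 'n" where "vec = extend (\<lambda>l. axis (e l) 1)"
  have adm: "adm vec" unfolding vec_def by (rule extend_adm)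
  have vb: "vec l = axis (e l) 1" if "l \<in> base" for l
    unfolding vec_def using extend_base[OF that] .
  have baseL: "base \<subseteq> L" by (auto simp: base_def)
  have ax: "axis i 1 \<in> vec ` base" for i
  proof -
    obtain l where l: "l \<in> base" "e l = i"
      using bij_betw_imp_surj_on[OF e] by (metis UNIV_I imageE)
    then have "axis i 1 = vec l" using vb[of l] by simp
    then show ?thesis using l(1) by blast
  qed
  have "fano_model K p m \<alpha> \<beta> vec"
  proof unfold_locales
    show "adm vec" by fact
    show "dimension = CARD('n)" by fact
    have G: "add_subgroup (int_lattice :: (real ^ 'n) set)"
      by (auto simp: add_subgroup_def int_lattice_def)
    show "vec l \<in> int_lattice" if "l \<in> L" for l
      by (rule adm_base_subgroup[OF G adm _ that]) (simp only: vb axis_in_int_lattice)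
    show "int_lattice \<subseteq> G" if G: "add_subgroup G" and sub: "vec ` L \<subseteq> G" for G
    proof
      fix x :: "real ^ 'n" assume x: "x \<in> int_lattice"
      have "\<forall>i. \<exists>k :: int. x $ i = of_int k" using x by (auto simp: int_lattice_def Ints_def)
      then obtain k :: "'n \<Rightarrow> int" where k: "\<And>i. x $ i = of_int (k i)" by metis
      have "axis i 1 \<in> G" for i :: 'n
        using ax[of i] sub baseL by blast
      then have "(\<Sum>i\<in>UNIV. of_int (k i) *\<^sub>R axis i 1) \<in> G"
        by (intro add_subgroupD(5)[OF G] add_subgroup_int_scale[OF G])
      then show "x \<in> G"
        using basis_expansion[of x] by (simp add: scalar_mult_eq_scaleR k)
    qed
    show "\<exists>a. \<forall>l\<in>L. a \<bullet> vec l = \<phi> l" if \<phi>: "adm \<phi>" for \<phi> :: "lab \<Rightarrow> real"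
    proof -
      define a :: "real ^ 'n" where "a = (\<chi> i. \<phi> (inv_into base e i))"
      have "a \<bullet> vec l = \<phi> l" if "l \<in> base" for l
        using that e by (simp add: a_def vb inner_axis bij_betw_def)
      then have "a \<bullet> vec l = \<phi> l" if "l \<in> L" for l
        using adm_base_eq[OF adm_inner[OF adm, of a] \<phi> _ that] by blast
      then show ?thesis by blast
    qed
  qed
  then show ?thesis by blast
qed

lemma isolated_exists:
  assumes dim: "dimension = CARD('n::finite)"
    and crit: "2 \<le> p \<or> ((\<exists>j<m. 1 \<le> \<alpha> j) \<and> (\<exists>j<m. 1 \<le> \<beta> j))"
  shows "\<exists>P :: (real ^ 'n) set. I_isolated P \<and> card (vertices P) = CARD('n) + 3 + m"
proof -
  obtain vec :: "lab \<Rightarrow> real ^ 'n" where "fano_model K p m \<alpha> \<beta> vec"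
    using model_exists[OF dim] by blast
  then interpret fano_model K p m \<alpha> \<beta> vec .
  have "I_isolated (convex hull (vec ` L))"
    using model_smooth_fano(1) no_vertex_addable no_vertex_removable[OF crit]
    by (intro I_isolatedI) auto
  then show ?thesis using card_vertices by blast
qed

end

theorem corollary4p6:
  fixes \<rho> :: nat
  assumes "5 \<le> CARD('n::finite)"
    and "3 \<le> \<rho>"
    and "\<rho> \<le> CARD('n)"
  shows "\<exists>P :: (real ^ 'n) set. I_isolated P \<and> card (vertices P) = CARD('n) + \<rho>"
proof -
  consider "\<rho> = 3" | "\<rho> = 4" | "5 \<le> \<rho>" using assms(2) by linarith
  then show ?thesis
  proof cases
    \<comment> \<open>no blocks; with \<open>p = 2\<close> all \<open>y_i\<close> and \<open>u_i\<close> have separating functionals\<close>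
    case 1
    interpret fano_params "CARD('n) - 3" 2 0 "\<lambda>_. 0" "\<lambda>_. 0"
      using assms by unfold_locales auto
    have "dimension = CARD('n)" unfolding dimension_def using assms by simp
    from isolated_exists[OF this] show ?thesis using 1 by simp
  next
    \<comment> \<open>a single block of three vertices with sum \<open>y + u\<close>, which protects both \<open>y\<close> and \<open>u\<close>\<close>
    case 2
    interpret fano_params "CARD('n) - 3" 1 1 "\<lambda>_. 1" "\<lambda>_. 1"
      using assms by unfold_locales auto
    have "dimension = CARD('n)" unfolding dimension_def using assms by simp
    from isolated_exists[OF this] show ?thesis using 2 by (simp add: add.commute)
  next
    \<comment> \<open>blocks of two vertices, the first one with sum \<open>y\<close> and the others with sum \<open>u\<close>\<close>
    case 3
    let ?\<alpha> = "\<lambda>j :: nat. if j = 0 then 1 else 0 :: nat"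
    let ?\<beta> = "\<lambda>j :: nat. if j = 0 then 0 else 1 :: nat"
    interpret fano_params "CARD('n) - \<rho> + 2" 1 "\<rho> - 3" ?\<alpha> ?\<beta>
      by unfold_locales auto
    have "(\<Sum>j<\<rho> - 3. 1 * (?\<alpha> j + ?\<beta> j)) = (\<Sum>j<\<rho> - 3. 1)"
      by (intro sum.cong) auto
    then have "dimension = CARD('n)" unfolding dimension_def using assms 3 by simp
    moreover have "(\<exists>j<\<rho> - 3. 1 \<le> ?\<alpha> j) \<and> (\<exists>j<\<rho> - 3. 1 \<le> ?\<beta> j)"
      using 3 by (intro conjI exI[of _ 0] exI[of _ 1]) auto
    ultimately have "\<exists>P :: (real ^ 'n) set. I_isolated P \<and> card (vertices P) = CARD('n) + 3 + (\<rho> - 3)"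
      by (intro isolated_exists) auto
    then show ?thesis using 3 by simp
  qed
qed

end
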